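(* Let $\Sigma_A$ be an irreducible subshift of finite type on the alphabet $\mathcal{J}=\{0,1,\dots,M-1\}$, with associated contracting similarities $S_i(x)=r_iT_i(x)+v_i$ ($i\in\mathcal{J}$) of $\mathbb{R}^d$, such that at least one $F_A^i$ ($i\in\mathcal{J}$) contains at least two points, and let $j\in\mathcal{J}$. Then for every $\varepsilon>0$ there exists a self-similar iterated function system (SS-IFS) $\{\widetilde S_i\}_{i=1}^m$ in $\mathbb{R}^d$ that satisfies the strong separation condition, with attractor $K$, such that $K\subseteq F_A^j\subseteq F_A$, $\dim_H F_A-\varepsilon<\dim_H K$, and the transformation group $\mathcal{T}$ of $\{\widetilde S_i\}_{i=1}^m$ is dense in $\mathcal{T}_{j,A}^G$.
   Context: Subshifts of finite type. Let $\mathcal{J}=\{0,1,\dots,M-1\}$ and let $A$ be an $M\times M$ matrix indexed by $\mathcal{J}\times\mathcal{J}$ with entries in $\{0,1\}$. Put $\Sigma_A=\{\alpha=(\alpha_0,\alpha_1,\dots)\in\mathcal{J}^{\mathbb{N}}:A_{\alpha_i,\alpha_{i+1}}=1\text{ for all }i=0,1,\dots\}$. $\Sigma_A$ is irreducible if for all $i,j\in\mathcal{J}$ there is a positive integer $n$ with $(A^n)_{i,j}>0$. To each $i\in\mathcal{J}$ is associated a contracting similarity $S_i(x)=r_iT_i(x)+v_i$ of $\mathbb{R}^d$ with $r_i\in(0,1)$, $T_i\in\mathbb{O}_d$ (the orthogonal group), $v_i\in\mathbb{R}^d$. For $\alpha\in\mathcal{J}^{\mathbb{N}}$ let $\Pi(\alpha)=\lim_{k\to\infty}S_{\alpha_0}\circ\cdots\circ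 S_{\alpha_{k-1}}(0)$. Put $F_A=\Pi(\Sigma_A)$ and $F_A^j=\Pi(\{\alpha\in\Sigma_A:\alpha_0=j\})$. The $j$-th transformation group $\mathcal{T}_{j,A}^G$ is the group generated by all $T_{\alpha_0}\circ T_{\alpha_1}\circ\cdots\circ T_{\alpha_{k-1}}$ where $k\ge1$, $(\alpha_0,\dots,\alpha_{k-1})\in\mathcal{J}^k$, $\alpha_0=j$, $A_{\alpha_i,\alpha_{i+1}}=1$ for $0\le i\le k-2$, and $A_{\alpha_{k-1},j}=1$. Self-similar systems. An SS-IFS in $\mathbb{R}^d$ is a finite collection $\{\widetilde S_i\}_{i=1}^m$ of contracting similarities of $\mathbb{R}^d$, $\widetilde S_i(x)=\widetilde r_i\widetilde T_i(x)+\widetilde v_i$ with $0<\widetilde r_i<1$, $\widetilde T_i\in\mathbb{O}_d$, $\widetilde v_i\in\mathbb{R}^d$. Its attractor is the unique nonempty compact $K$ with $K=\bigcup_{i=1}^m\widetilde S_i(K)$; the strong separation condition (SSC) means that the sets $\widetilde S_1(K),\dots,\widetilde S_m(K)$ are pairwise disjoint. The transformation group $\mathcal{T}$ is the group generated by $\widetilde T_1,\dots,\widetilde T_m$. $\dim_H$ is Hausdorff dimension. Density is with respect to the usual topology of $\mathbb{O}_d$; "$\mathcal T$ is dense in $\mathcal{T}_{j,A}^G$" means $\mathcal T$ is a dense subset of it. *)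

theory Defs
  imports
    "Jordan_Normal_Form.Matrix"
    "HOL-Algebra.Generated_Groups"
    "HOL-Analysis.Analysis"
begin

section \<open>Hausdorff dimension\<close>

text \<open>
  The contribution of a covering set, \<open>diam(U)^s\<close> with the conventions that the empty set
  contributes 0 and that \<open>0^0 = 1\<close> for a nonempty set (the library has \<open>0 powr 0 = 0\<close>).
\<close>
definition hausdorff_gauge :: "real \<Rightarrow> 'a::metric_space set \<Rightarrow> ennreal" where
  "hausdorff_gauge s U =
     (if U = {} then 0 else if s = 0 then 1 else ennreal (diameter U powr s))"

text \<open>
  Boundedness is required explicitly because \<open>diameter\<close> has no meaningful value on an
  unbounded set. Finite covers are included, since the \<open>U i\<close> may be empty.
\<close>
definition delta_covers :: "real \<Rightarrow> 'a::metric_space set \<Rightarrow> (nat \<Rightarrow> 'a set) set" where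
  "delta_covers \<delta> E = {U. E \<subseteq> (\<Union>i. U i) \<and> (\<forall>i. bounded (U i) \<and> diameter (U i) \<le> \<delta>)}"

definition hausdorff_premeasure :: "real \<Rightarrow> real \<Rightarrow> 'a::metric_space set \<Rightarrow> ennreal" where
  "hausdorff_premeasure s \<delta> E = (INF U\<in>delta_covers \<delta> E. (\<Sum>i. hausdorff_gauge s (U i)))"

text \<open>The supremum is the limit as \<open>\<delta>\<close> decreases to 0, by monotonicity in \<open>\<delta>\<close>.\<close>
definition hausdorff_measure :: "real \<Rightarrow> 'a::metric_space set \<Rightarrow> ennreal" where
  "hausdorff_measure s E = (SUP \<delta>\<in>{0<..}. hausdorff_premeasure s \<delta> E)"

definition hausdorff_dim :: "'a::metric_space set \<Rightarrow> ereal" where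
  "hausdorff_dim E = Inf {ereal s | s. 0 \<le> s \<and> hausdorff_measure s E = 0}"

section \<open>Similarities and the orthogonal group\<close>

definition similarity :: "real \<Rightarrow> real^'d^'d \<Rightarrow> real^'d \<Rightarrow> real^'d \<Rightarrow> real^'d" where
  "similarity r T v x = r *\<^sub>R (T *v x) + v"

text \<open>The indices of a system of \<open>m\<close> maps are \<open>0, \<dots>, m - 1\<close>; values at other indices are irrelevant.\<close>
definition contracting_similarities :: "nat \<Rightarrow> (nat \<Rightarrow> real) \<Rightarrow> (nat \<Rightarrow> real^'d^'d) \<Rightarrow> bool" where
  "contracting_similarities m r T \<longleftrightarrow> (\<forall>i<m. 0 < r i \<and> r i < 1 \<and> orthogonal_matrix (T i))"

definition sim_system ::
    "(nat \<Rightarrow> real) \<Rightarrow> (nat \<Rightarrow> real^'d^'d) \<Rightarrow> (nat \<Rightarrow> real^'d) \<Rightarrow> nat \<Rightarrow> real^'d \<Rightarrow> real^'d" where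
  "sim_system r T v i = similarity (r i) (T i) (v i)"

text \<open>
  Orthogonal maps are identified with their matrices, so that the topology is the one of
  \<open>real^'d^'d\<close>.
\<close>
definition orthogonal_group :: "(real^'d^'d) monoid" where
  "orthogonal_group = \<lparr>carrier = {Q. orthogonal_matrix Q}, monoid.mult = (**), one = mat 1\<rparr>"

definition dense_subset :: "'a::topological_space set \<Rightarrow> 'a set \<Rightarrow> bool" where
  "dense_subset D X \<longleftrightarrow> D \<subseteq> X \<and> X \<subseteq> closure D"

section \<open>Subshifts of finite type\<close>

definition subshift :: "nat \<Rightarrow> nat mat \<Rightarrow> (nat \<Rightarrow> nat) set" where
  "subshift M A = {\<alpha>. (\<forall>i. \<alpha> i < M) \<and> (\<forall>i. A $$ (\<alpha> i, \<alpha> (Suc i)) = 1)}"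

definition irreducible_subshift :: "nat \<Rightarrow> nat mat \<Rightarrow> bool" where
  "irreducible_subshift M A \<longleftrightarrow> (\<forall>i<M. \<forall>j<M. \<exists>n>0. (A ^\<^sub>m n) $$ (i, j) > 0)"

fun prefix_comp :: "(nat \<Rightarrow> 'a \<Rightarrow> 'a) \<Rightarrow> (nat \<Rightarrow> nat) \<Rightarrow> nat \<Rightarrow> 'a \<Rightarrow> 'a" where
  "prefix_comp S \<alpha> 0 = id"
| "prefix_comp S \<alpha> (Suc k) = prefix_comp S \<alpha> k \<circ> S (\<alpha> k)"

definition coding_map ::
    "(nat \<Rightarrow> 'a \<Rightarrow> 'a) \<Rightarrow> (nat \<Rightarrow> nat) \<Rightarrow> 'a::real_normed_vector" where
  "coding_map S \<alpha> = lim (\<lambda>k. prefix_comp S \<alpha> k 0)"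

definition sft_attractor ::
    "nat \<Rightarrow> nat mat \<Rightarrow> (nat \<Rightarrow> 'a \<Rightarrow> 'a) \<Rightarrow> 'a::real_normed_vector set" where
  "sft_attractor M A S = coding_map S ` subshift M A"

definition sft_attractor_at ::
    "nat \<Rightarrow> nat mat \<Rightarrow> (nat \<Rightarrow> 'a \<Rightarrow> 'a) \<Rightarrow> nat \<Rightarrow> 'a::real_normed_vector set" where
  "sft_attractor_at M A S j = coding_map S ` {\<alpha> \<in> subshift M A. \<alpha> 0 = j}"

definition loop_words :: "nat \<Rightarrow> nat mat \<Rightarrow> nat \<Rightarrow> nat list set" where
  "loop_words M A j = {w. w \<noteq> [] \<and> set w \<subseteq> {..<M} \<and> hd w = j \<and>
     (\<forall>i. Suc i < length w \<longrightarrow> A $$ (w ! i, w ! Suc i) = 1) \<and> A $$ (last w, j) = 1}"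

definition sft_transformation_group ::
    "nat \<Rightarrow> nat mat \<Rightarrow> (nat \<Rightarrow> real^'d^'d) \<Rightarrow> nat \<Rightarrow> (real^'d^'d) set" where
  "sft_transformation_group M A T j =
     generate orthogonal_group ((\<lambda>w. foldr (**) (map T w) (mat 1)) ` loop_words M A j)"

section \<open>Self-similar iterated function systems\<close>

text \<open>By Hutchinson's theorem a finite nonempty system of contractions has exactly one such \<open>K\<close>;
  for \<open>m = 0\<close> there is none.\<close>
definition ifs_attractor ::
    "nat \<Rightarrow> (nat \<Rightarrow> 'a \<Rightarrow> 'a) \<Rightarrow> 'a::topological_space set \<Rightarrow> bool" where
  "ifs_attractor m S K \<longleftrightarrow> K \<noteq> {} \<and> compact K \<and> K = (\<Union>i<m. S i ` K)"

text \<open>To be used with \<open>K\<close> the attractor of the system.\<close>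
definition strong_separation :: "nat \<Rightarrow> (nat \<Rightarrow> 'a \<Rightarrow> 'a) \<Rightarrow> 'a set \<Rightarrow> bool" where
  "strong_separation m S K \<longleftrightarrow> (\<forall>i<m. \<forall>k<m. i \<noteq> k \<longrightarrow> S i ` K \<inter> S k ` K = {})"

definition ifs_transformation_group :: "nat \<Rightarrow> (nat \<Rightarrow> real^'d^'d) \<Rightarrow> (real^'d^'d) set" where
  "ifs_transformation_group m T = generate orthogonal_group (T ` {..<m})"

end

theory Submission
  imports Defs
begin

text \<open>
  A loop \<open>w\<close> at \<open>j\<close> in the transition graph gives a similarity that maps the piece \<open>F\<^sub>A\<^sup>j\<close> into itself. Hence any
  finite nonempty family of loops whose maps have disjoint images of \<open>F\<^sub>A\<^sup>j\<close> is a strongly separated system, and its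
  attractor lies in \<open>F\<^sub>A\<^sup>j\<close> because this set is compact (\<open>self_similar_system_of_loops\<close>). It remains to find a
  family with large dimension and the full transformation group.

  Dimension: let \<open>t < t' < dim F\<^sub>A\<close>. A Vitali covering argument selects among the words of a given length
  some with disjoint cylinders, and since the \<open>t'\<close>-dimensional measure of \<open>F\<^sub>A\<close> is positive, the sums of the
  \<open>t\<close>-th powers of their ratios become arbitrarily large as the length grows
  (\<open>disjoint_cylinders_large_sum\<close>). Irreducibility completes these words to loops at \<open>j\<close> at the price of a
  constant factor, so the sum can be made at least 1, and then the attractor has dimension at least \<open>t\<close>
  (\<open>self_similar_dim_lower_bound\<close>).

  Transformation group: it is generated by the rotations of finitely many loops
  (\<open>loop_rotations_generated\<close>). To include these loops without destroying separation, take two loops \<open>a\<close>, \<open>b\<close>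
  with disjoint images, which exist because some piece has two points (\<open>two_disjoint_loops\<close>), and replace
  each loop \<open>x\<close> by \<open>a\<^sup>k b x\<close> with its own \<open>k\<close>. Together with the loops \<open>b\<close> and \<open>a b\<close>, whose rotations determine those
  of \<open>a\<close> and \<open>b\<close>, the modified loops still generate everything (\<open>tagged_rotations_generate\<close>). The words that carry the
  dimension are tagged in the same way, so the transformation group of the system is not merely dense in that
  of the subshift: the two are equal (\<open>self_similar_subsystem\<close>).
\<close>

section \<open>Hausdorff measures and covers\<close>

lemma hausdorff_gauge_powr:
  "0 < s \<Longrightarrow> hausdorff_gauge s U = ennreal (diameter U powr s)"
  by (simp add: hausdorff_gauge_def)

lemma hausdorff_premeasure_finite_cover:
  assumes "finite D" and "E \<subseteq> (\<Union>i\<in>D. U i)" and "0 \<le> \<delta>"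
    and "\<And>i. i \<in> D \<Longrightarrow> bounded (U i) \<and> diameter (U i) \<le> \<delta>"
  shows "hausdorff_premeasure s \<delta> E \<le> (\<Sum>i\<in>D. hausdorff_gauge s (U i))"
proof -
  obtain h where h: "bij_betw h {..<card D} D"
    using ex_bij_betw_nat_finite[OF assms(1)] by (auto simp: atLeast0LessThan)
  define V where "V n = (if n < card D then U (h n) else {})" for n
  have hD: "h n \<in> D" if "n < card D" for n
    using h that by (auto simp: bij_betw_def)
  have "E \<subseteq> (\<Union>n. V n)"
  proof
    fix x assume "x \<in> E"
    then obtain i where i: "i \<in> D" "x \<in> U i" using assms(2) by auto
    then obtain n where "n < card D" "h n = i"
      using h unfolding bij_betw_def by (metis imageE lessThan_iff)
    then show "x \<in> (\<Union>n. V n)" using i by (auto simp: V_def intro!: exI[of _ n])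
  qed
  then have "V \<in> delta_covers \<delta> E"
    using assms(3,4) hD by (auto simp: delta_covers_def V_def)
  then have "hausdorff_premeasure s \<delta> E \<le> (\<Sum>n. hausdorff_gauge s (V n))"
    unfolding hausdorff_premeasure_def by (rule INF_lower)
  also have "\<dots> = (\<Sum>n<card D. hausdorff_gauge s (V n))"
    by (rule suminf_finite) (auto simp: V_def hausdorff_gauge_def)
  also have "\<dots> = (\<Sum>n<card D. hausdorff_gauge s (U (h n)))"
    by (intro sum.cong) (auto simp: V_def)
  also have "\<dots> = (\<Sum>i\<in>D. hausdorff_gauge s (U i))"
    using sum.reindex_bij_betw[OF h] by simp
  finally show ?thesis .
qed

lemma diameter_bound_real_normed:
  fixes X :: "'a::real_normed_vector set"
  assumes "0 \<le> e" and "\<And>x y. x \<in> X \<Longrightarrow> y \<in> X \<Longrightarrow> dist x y \<le> e"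
  shows "bounded X" and "diameter X \<le> e"
proof -
  show "bounded X"
    using assms(2) unfolding bounded_def by blast
  show "diameter X \<le> e"
    using assms by (intro diameter_le) (auto simp: dist_norm)
qed

lemma open_thickening_powr:
  fixes U :: "'a::euclidean_space set"
  assumes "bounded U" and "0 < t" and "0 < e"
  obtains V where "open V" "U \<subseteq> V" "bounded V" "diameter V powr t \<le> diameter U powr t + e"
proof -
  have dU: "0 \<le> diameter U"
    using diameter_ge_0[OF assms(1)] .
  have "((\<lambda>h. (diameter U + 2 * h) powr t) \<longlongrightarrow> (diameter U + 2 * 0) powr t) (at_right 0)"
    using assms(2) dU
    by (intro tendsto_powr' tendsto_intros) (auto simp: eventually_at_right_less
          intro!: eventually_at_rightI[of 0 1])
  then have "\<forall>\<^sub>F h in at_right 0. (diameter U + 2 * h) powr t < diameter U powr t + e"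
    using assms(3) by (intro order_tendstoD(2)) auto
  then have "\<forall>\<^sub>F h in at_right 0. (diameter U + 2 * h) powr t < diameter U powr t + e \<and> (0::real) < h"
    by (intro eventually_conj eventually_at_right_less)
  then obtain h where h: "(diameter U + 2 * h) powr t < diameter U powr t + e" "0 < h"
    by (rule eventually_happens'[OF trivial_limit_at_right_real, THEN exE]) blast
  define V where "V = (\<Union>u\<in>U. ball u h)"
  have d: "dist x y \<le> diameter U + 2 * h" if xy: "x \<in> V" "y \<in> V" for x y
  proof -
    obtain u w where u: "u \<in> U" "dist x u < h" and w: "w \<in> U" "dist w y < h"
      using xy by (auto simp: V_def dist_commute)
    have "dist x y \<le> dist x u + dist u w + dist w y"
      using dist_triangle[of x y u] dist_triangle[of u y w] by linarith
    then show ?thesis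
      using u w diameter_bounded_bound[OF assms(1) u(1) w(1)] by (simp add: dist_commute)
  qed
  have bd: "bounded V" "diameter V \<le> diameter U + 2 * h"
    using diameter_bound_real_normed[OF _ d] dU h(2) by auto
  show ?thesis
  proof (rule that)
    show "open V" "U \<subseteq> V" using h(2) by (auto simp: V_def)
    have "diameter V powr t \<le> (diameter U + 2 * h) powr t"
      using bd assms(2) diameter_ge_0 by (intro powr_mono2) auto
    then show "diameter V powr t \<le> diameter U powr t + e" using h by simp
  qed (use bd in auto)
qed

text \<open>
  Compactness reduces countable covers to finite ones. The sets of a cover need not be open, so each
  is thickened first, at a total extra cost of \<open>c / 2\<close>; hence the factor \<open>1 / 2\<close> in the conclusion.
\<close>
lemma hausdorff_premeasure_lower_bound_compact:
  fixes K :: "'a::euclidean_space set"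
  assumes "compact K" and "0 < t" and "0 < c"
    and fin: "\<And>(I::nat set) V. finite I \<Longrightarrow> K \<subseteq> (\<Union>i\<in>I. V i) \<Longrightarrow> (\<And>i. bounded (V i)) \<Longrightarrow>
              c \<le> (\<Sum>i\<in>I. diameter (V i) powr t)"
  shows "ennreal (c / 2) \<le> hausdorff_premeasure t \<delta> K"
  unfolding hausdorff_premeasure_def
proof (rule INF_greatest)
  fix U assume U: "U \<in> delta_covers \<delta> K"
  then have bU: "bounded (U i)" for i by (auto simp: delta_covers_def)
  have "\<exists>V. open V \<and> U i \<subseteq> V \<and> bounded V \<and>
          diameter V powr t \<le> diameter (U i) powr t + c / 2 * (1 / 2) ^ Suc i" for i
    by (rule open_thickening_powr[OF bU assms(2), of "c / 2 * (1 / 2) ^ Suc i"])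
      (use assms(3) in auto)
  then obtain V where V: "\<And>i. open (V i)" "\<And>i. U i \<subseteq> V i" "\<And>i. bounded (V i)"
    "\<And>i. diameter (V i) powr t \<le> diameter (U i) powr t + c / 2 * (1 / 2) ^ Suc i"
    by metis
  have "K \<subseteq> (\<Union>i. V i)" using U V(2) by (fastforce simp: delta_covers_def)
  then obtain I where I: "finite I" "K \<subseteq> (\<Union>i\<in>I. V i)"
    using compactE_image[OF assms(1), of UNIV V] V(1) by metis
  have geo: "(\<lambda>i. (1 / 2 :: real) ^ Suc i) sums 1"
    by (rule power_half_series)
  have "c \<le> (\<Sum>i\<in>I. diameter (V i) powr t)"
    using fin[OF I V(3)] .
  also have "\<dots> \<le> (\<Sum>i\<in>I. diameter (U i) powr t + c / 2 * (1 / 2) ^ Suc i)"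
    by (intro sum_mono V)
  also have "\<dots> = (\<Sum>i\<in>I. diameter (U i) powr t) + c / 2 * (\<Sum>i\<in>I. (1 / 2) ^ Suc i)"
    by (simp add: sum.distrib sum_distrib_left)
  also have "(\<Sum>i\<in>I. (1 / 2 :: real) ^ Suc i) \<le> 1"
    using sum_le_suminf[OF sums_summable[OF geo] I(1)] sums_unique[OF geo] by simp
  finally have "c / 2 \<le> (\<Sum>i\<in>I. diameter (U i) powr t)"
    using assms(3) by simp
  then have "ennreal (c / 2) \<le> ennreal (\<Sum>i\<in>I. diameter (U i) powr t)"
    by (rule ennreal_leI)
  also have "\<dots> = (\<Sum>i\<in>I. hausdorff_gauge t (U i))"
    using assms(2) by (simp add: sum_ennreal hausdorff_gauge_powr)
  also have "\<dots> \<le> (\<Sum>i. hausdorff_gauge t (U i))"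
    by (rule sum_le_suminf) (auto simp: I)
  finally show "ennreal (c / 2) \<le> (\<Sum>i. hausdorff_gauge t (U i))" .
qed

lemma hausdorff_measure_pos_imp_premeasure_pos:
  assumes "hausdorff_measure s E \<noteq> 0"
  obtains \<delta> where "0 < \<delta>" "hausdorff_premeasure s \<delta> E \<noteq> 0"
proof -
  have "\<exists>\<delta>\<in>{0<..}. hausdorff_premeasure s \<delta> E \<noteq> 0"
  proof (rule ccontr)
    assume "\<not> ?thesis"
    then have "hausdorff_measure s E \<le> 0"
      unfolding hausdorff_measure_def by (intro SUP_least) auto
    then show False using assms by simp
  qed
  then show ?thesis using that by auto
qed

lemma hausdorff_premeasure_le_measure:
  "0 < \<delta> \<Longrightarrow> hausdorff_premeasure s \<delta> E \<le> hausdorff_measure s E"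
  unfolding hausdorff_measure_def by (rule SUP_upper) auto

lemma hausdorff_dim_nonneg: "0 \<le> hausdorff_dim E"
  unfolding hausdorff_dim_def by (rule Inf_greatest) auto

lemma hausdorff_measure_nonzero_below_dim:
  assumes "0 \<le> t" and "ereal t < hausdorff_dim E"
  shows "hausdorff_measure t E \<noteq> 0"
proof
  assume "hausdorff_measure t E = 0"
  then have "hausdorff_dim E \<le> ereal t"
    unfolding hausdorff_dim_def using assms(1) by (intro Inf_lower) auto
  then show False using assms(2) by simp
qed

text \<open>
  Bounds through \<open>diameter U powr s\<close> do not reach the exponent 0, because \<open>0 powr 0 = 0\<close>, while the gauge
  counts a nonempty set as 1.
\<close>
lemma hausdorff_measure_zero_exponent:
  assumes "E \<noteq> {}"
  shows "1 \<le> hausdorff_measure 0 E"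
proof -
  have "1 \<le> hausdorff_premeasure 0 1 E"
    unfolding hausdorff_premeasure_def
  proof (rule INF_greatest)
    fix U assume "U \<in> delta_covers 1 E"
    then obtain i where "U i \<noteq> {}" using assms by (fastforce simp: delta_covers_def)
    then have "1 = (\<Sum>i\<in>{i}. hausdorff_gauge 0 (U i))" by (simp add: hausdorff_gauge_def)
    also have "\<dots> \<le> (\<Sum>i. hausdorff_gauge 0 (U i))"
      by (rule sum_le_suminf) auto
    finally show "1 \<le> (\<Sum>i. hausdorff_gauge 0 (U i))" .
  qed
  also have "\<dots> \<le> hausdorff_measure 0 E"
    by (rule hausdorff_premeasure_le_measure) simp
  finally show ?thesis .
qed

section \<open>Dimension of strongly separated self-similar sets\<close>

lemma uniform_gap:
  fixes P :: "nat \<Rightarrow> 'a::euclidean_space set"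
  assumes "\<And>i. i < m \<Longrightarrow> compact (P i)"
    and "\<And>i k. i < m \<Longrightarrow> k < m \<Longrightarrow> i \<noteq> k \<Longrightarrow> P i \<inter> P k = {}"
  obtains g where "0 < g"
    "\<And>i k x y. i < m \<Longrightarrow> k < m \<Longrightarrow> i \<noteq> k \<Longrightarrow> x \<in> P i \<Longrightarrow> y \<in> P k \<Longrightarrow> g \<le> dist x y"
proof -
  have "\<exists>g>0. \<forall>x\<in>P i. \<forall>y\<in>P k. g \<le> dist x y" if "i < m" "k < m" "i \<noteq> k" for i k
    using separate_compact_closed[of "P i" "P k"] assms that compact_imp_closed by metis
  then obtain g where g: "\<And>i k. i < m \<Longrightarrow> k < m \<Longrightarrow> i \<noteq> k \<Longrightarrow>
      0 < g i k \<and> (\<forall>x\<in>P i. \<forall>y\<in>P k. g i k \<le> dist x y)"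
    by metis
  define G where "G = insert 1 ((\<lambda>(i, k). g i k) ` {(i, k). i < m \<and> k < m \<and> i \<noteq> k})"
  have "finite {(i, k). i < m \<and> k < m \<and> i \<noteq> k}"
    by (rule finite_subset[of _ "{..<m} \<times> {..<m}"]) auto
  then have G: "finite G" "G \<noteq> {}" by (auto simp: G_def)
  show ?thesis
  proof (rule that[of "Min G"])
    show "0 < Min G" using G g by (subst Min_gr_iff) (auto simp: G_def)
    fix i k x y assume a: "i < m" "k < m" "i \<noteq> k" "x \<in> P i" "y \<in> P k"
    then have "Min G \<le> g i k" using G(1) by (intro Min_le) (auto simp: G_def)
    also have "\<dots> \<le> dist x y" using g a by auto
    finally show "Min G \<le> dist x y" .
  qed
qed

text \<open>
  A lower bound for covers without constructing a measure, by induction on the number of sets. If some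
  set has diameter at least the gap \<open>g\<close> between pieces, it alone suffices. Otherwise every set meets at
  most one piece, and pulling back the sets that meet the \<open>k\<close>-th piece along \<open>f k\<close> gives a cover of \<open>K\<close>
  by fewer sets, which multiplies its sum by at most \<open>r k powr (- t)\<close>. Adding up the induction hypotheses
  and using \<open>1 \<le> (\<Sum>k<m. r k powr t)\<close> returns the same bound.
\<close>
lemma self_similar_finite_cover_sum:
  fixes K :: "'a::euclidean_space set" and f :: "nat \<Rightarrow> 'a \<Rightarrow> 'a" and I :: "nat set"
  assumes K: "K \<noteq> {}" "K = (\<Union>k<m. f k ` K)"
    and sim: "\<And>k x y. k < m \<Longrightarrow> dist (f k x) (f k y) = r k * dist x y"
    and r: "\<And>k. k < m \<Longrightarrow> 0 < r k"
    and gap: "\<And>i k x y. i < m \<Longrightarrow> k < m \<Longrightarrow> i \<noteq> k \<Longrightarrow> x \<in> f i ` K \<Longrightarrow> y \<in> f k ` K \<Longrightarrow> g \<le> dist x y"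
    and g: "0 < g" and m: "2 \<le> m" and t: "0 < t" and sum1: "1 \<le> (\<Sum>k<m. r k powr t)"
    and I: "finite I" "K \<subseteq> (\<Union>i\<in>I. V i)" "\<And>i. bounded (V i)"
  shows "g powr t \<le> (\<Sum>i\<in>I. diameter (V i) powr t)"
  using I
proof (induction "card I" arbitrary: I V rule: less_induct)
  case less
  note bV = less.prems(3)
  show ?case
  proof (cases "\<exists>i\<in>I. g \<le> diameter (V i)")
    case True
    then obtain i where i: "i \<in> I" "g \<le> diameter (V i)" by auto
    have "g powr t \<le> diameter (V i) powr t" using i g t by (intro powr_mono2) auto
    also have "\<dots> \<le> (\<Sum>i\<in>I. diameter (V i) powr t)"
      using i less.prems(1) by (intro member_le_sum) auto
    finally show ?thesis .
  next
    case False
    define J where "J k = {i \<in> I. V i \<inter> f k ` K \<noteq> {}}" for k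
    have finJ: "finite (J k)" for k using less.prems(1) by (auto simp: J_def)
    have Jne: "J k \<noteq> {}" if "k < m" for k
    proof -
      obtain x where x: "x \<in> K" using K(1) by auto
      then have "f k x \<in> K" using K(2) that by blast
      then obtain i where "i \<in> I" "f k x \<in> V i" using less.prems(2) by blast
      then show ?thesis using x by (auto simp: J_def)
    qed
    have Jdisj: "J k \<inter> J l = {}" if kl: "k < m" "l < m" "k \<noteq> l" for k l
    proof (rule ccontr)
      assume "J k \<inter> J l \<noteq> {}"
      then obtain i x y where i: "i \<in> I" "x \<in> V i" "x \<in> f k ` K" "y \<in> V i" "y \<in> f l ` K"
        by (auto simp: J_def)
      have "g \<le> dist x y" using gap[OF kl i(3,5)] .
      also have "\<dots> \<le> diameter (V i)" using diameter_bounded_bound[OF bV i(2,4)] .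
      finally show False using False i(1) by auto
    qed
    have step: "r k powr t * g powr t \<le> (\<Sum>i\<in>J k. diameter (V i) powr t)" if k: "k < m" for k
    proof -
      \<comment> \<open>Pulled back along \<open>f k\<close>, the sets meeting the \<open>k\<close>-th piece cover all of \<open>K\<close>.\<close>
      define V' where "V' i = f k -` V i" for i
      \<comment> \<open>A second piece exists because \<open>2 \<le> m\<close>, and the sets meeting it are not in \<open>J k\<close>.\<close>
      define l where "l = (if k = 0 then 1 else 0 :: nat)"
      have l: "l < m" "k \<noteq> l" using m by (auto simp: l_def)
      have "J k \<subseteq> I" "J l \<subseteq> I" by (auto simp: J_def)
      then have "J k \<subset> I" using Jne[OF l(1)] Jdisj[OF k l] by blast
      then have card: "card (J k) < card I" using less.prems(1) by (simp add: psubset_card_mono)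
      have V'd: "dist x y \<le> diameter (V i) / r k" if "x \<in> V' i" "y \<in> V' i" for x y i
        using diameter_bounded_bound[OF bV, of "f k x" i "f k y"] that sim[OF k] r[OF k]
        by (auto simp: V'_def field_simps)
      have V'b: "bounded (V' i)" "diameter (V' i) \<le> diameter (V i) / r k" for i
        using diameter_bound_real_normed[of "diameter (V i) / r k" "V' i"] V'd r[OF k]
          diameter_ge_0[OF bV, of i] by auto
      have "K \<subseteq> (\<Union>i\<in>J k. V' i)"
      proof
        fix x assume x: "x \<in> K"
        then have "f k x \<in> K" using K(2) k by blast
        then obtain i where "i \<in> I" "f k x \<in> V i" using less.prems(2) by auto
        then show "x \<in> (\<Union>i\<in>J k. V' i)" using x by (auto simp: J_def V'_def)
      qed
      then have "g powr t \<le> (\<Sum>i\<in>J k. diameter (V' i) powr t)"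
        using less.hyps[OF card finJ] V'b by blast
      also have "\<dots> \<le> (\<Sum>i\<in>J k. (diameter (V i) / r k) powr t)"
        using V'b diameter_ge_0 t by (intro sum_mono powr_mono2) auto
      also have "\<dots> = (\<Sum>i\<in>J k. diameter (V i) powr t) / r k powr t"
        using r[OF k] diameter_ge_0[OF bV] by (simp add: powr_divide sum_divide_distrib)
      finally show ?thesis using r[OF k] by (simp add: field_simps)
    qed
    have "g powr t \<le> (\<Sum>k<m. r k powr t) * g powr t"
      using sum1 g by simp
    also have "\<dots> = (\<Sum>k<m. r k powr t * g powr t)" by (simp add: sum_distrib_right)
    also have "\<dots> \<le> (\<Sum>k<m. \<Sum>i\<in>J k. diameter (V i) powr t)" using step by (intro sum_mono) auto
    also have "\<dots> = (\<Sum>i\<in>(\<Union>k<m. J k). diameter (V i) powr t)"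
      using finJ Jdisj by (intro sum.UNION_disjoint[symmetric]) auto
    also have "\<dots> \<le> (\<Sum>i\<in>I. diameter (V i) powr t)"
      using less.prems(1) by (intro sum_mono2) (auto simp: J_def)
    finally show ?thesis .
  qed
qed

text \<open>
  The classical lower bound by the similarity dimension. The measures of all smaller exponents \<open>u\<close> have
  to be positive, and the hypothesis on the sum passes from \<open>t\<close> to \<open>u\<close> because the ratios are below 1.
\<close>
lemma self_similar_dim_lower_bound:
  fixes K :: "'a::euclidean_space set" and f :: "nat \<Rightarrow> 'a \<Rightarrow> 'a"
  assumes K: "K \<noteq> {}" "compact K" "K = (\<Union>k<m. f k ` K)"
    and disj: "\<And>i k. i < m \<Longrightarrow> k < m \<Longrightarrow> i \<noteq> k \<Longrightarrow> f i ` K \<inter> f k ` K = {}"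
    and sim: "\<And>k x y. k < m \<Longrightarrow> dist (f k x) (f k y) = r k * dist x y"
    and r: "\<And>k. k < m \<Longrightarrow> 0 < r k \<and> r k < 1"
    and m: "2 \<le> m" and sum1: "1 \<le> (\<Sum>k<m. r k powr t)"
  shows "ereal t \<le> hausdorff_dim K"
  unfolding hausdorff_dim_def
proof (rule Inf_greatest)
  fix e assume "e \<in> {ereal s |s. 0 \<le> s \<and> hausdorff_measure s K = 0}"
  then obtain u where u: "e = ereal u" "0 \<le> u" "hausdorff_measure u K = 0" by auto
  have "t \<le> u"
  proof (rule ccontr)
    assume "\<not> t \<le> u"
    have "compact (f k ` K)" if "k < m" for k
    proof (rule compact_continuous_image[OF _ K(2)])
      have "(r k)-lipschitz_on K (f k)"
        using sim that r by (intro lipschitz_onI) (auto intro: less_imp_le)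
      then show "continuous_on K (f k)" by (rule lipschitz_on_continuous_on)
    qed
    then obtain g where g: "0 < g"
      "\<And>i k x y. i < m \<Longrightarrow> k < m \<Longrightarrow> i \<noteq> k \<Longrightarrow> x \<in> f i ` K \<Longrightarrow> y \<in> f k ` K \<Longrightarrow> g \<le> dist x y"
      using uniform_gap[of m "\<lambda>k. f k ` K"] disj by blast
    have "u \<noteq> 0" using hausdorff_measure_zero_exponent[OF K(1)] u(3) by auto
    then have u0: "0 < u" using u(2) by simp
    have "(\<Sum>k<m. r k powr t) \<le> (\<Sum>k<m. r k powr u)"
      using \<open>\<not> t \<le> u\<close> r by (intro sum_mono powr_mono') (auto intro: less_imp_le)
    then have "1 \<le> (\<Sum>k<m. r k powr u)" using sum1 by simp
    then have "ennreal (g powr u / 2) \<le> hausdorff_premeasure u 1 K"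
      using g u0
      by (intro hausdorff_premeasure_lower_bound_compact[OF K(2)]
          self_similar_finite_cover_sum[OF K(1,3) sim _ _ _ m, where g = g]) (auto simp: r)
    also have "\<dots> \<le> hausdorff_measure u K" by (rule hausdorff_premeasure_le_measure) simp
    finally show False using u(3) g(1) by (simp add: ennreal_eq_0_iff)
  qed
  then show "ereal t \<le> e" using u by simp
qed

section \<open>Words labelling walks\<close>

text \<open>
  \<open>walk M A i w k\<close>: the word \<open>w\<close> lists the vertices of a walk from \<open>i\<close> to \<open>k\<close> in the transition graph, with the
  final vertex \<open>k\<close> omitted. With this convention concatenation of walks is concatenation of words, the
  empty word is the trivial walk, and the nonempty walks from \<open>j\<close> to \<open>j\<close> are the loop words at \<open>j\<close>.
\<close>
primrec walk :: "nat \<Rightarrow> nat mat \<Rightarrow> nat \<Rightarrow> nat list \<Rightarrow> nat \<Rightarrow> bool" where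
  "walk M A i [] k = (i = k)"
| "walk M A i (x # w) k = (x = i \<and> i < M \<and> (\<exists>l<M. A $$ (i, l) = 1 \<and> walk M A l w k))"

lemma walk_append: "walk M A i (u @ w) k \<longleftrightarrow> (\<exists>l. walk M A i u l \<and> walk M A l w k)"
  by (induction u arbitrary: i) auto

lemma walk_letters: "walk M A i w k \<Longrightarrow> set w \<subseteq> {..<M}"
  by (induction w arbitrary: i) auto

lemma walk_nonempty_iff:
  assumes "w \<noteq> []" and "k < M"
  shows "walk M A i w k \<longleftrightarrow> set w \<subseteq> {..<M} \<and> hd w = i \<and>
    (\<forall>l. Suc l < length w \<longrightarrow> A $$ (w ! l, w ! Suc l) = 1) \<and> A $$ (last w, k) = 1"
  using assms(1)
proof (induction w arbitrary: i)
  case (Cons x w)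
  show ?case
  proof (cases "w = []")
    case True
    then show ?thesis using assms(2) by auto
  next
    case False
    have nths: "(\<forall>l. Suc l < length (x # w) \<longrightarrow> A $$ ((x # w) ! l, (x # w) ! Suc l) = 1) \<longleftrightarrow>
        A $$ (x, hd w) = 1 \<and> (\<forall>l. Suc l < length w \<longrightarrow> A $$ (w ! l, w ! Suc l) = 1)"
      using False by (auto simp: hd_conv_nth nth_Cons split: nat.splits)
    have "walk M A l w k \<longleftrightarrow> set w \<subseteq> {..<M} \<and> hd w = l \<and>
        (\<forall>l. Suc l < length w \<longrightarrow> A $$ (w ! l, w ! Suc l) = 1) \<and> A $$ (last w, k) = 1" for l
      using Cons.IH[OF False] .
    moreover have "hd w < M" if "set w \<subseteq> {..<M}" using that False hd_in_set by blast
    ultimately show ?thesis using False unfolding nths by auto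
  qed
qed simp

lemma loop_words_eq_walks: "j < M \<Longrightarrow> loop_words M A j = {w. w \<noteq> [] \<and> walk M A j w j}"
  using walk_nonempty_iff[of _ j M A j] by (auto simp: loop_words_def)

lemma walk_of_positive_power_entry:
  assumes A: "A \<in> carrier_mat M M" "elements_mat A \<subseteq> {0, 1}"
    and "i < M" "k < M" "(A ^\<^sub>m n) $$ (i, k) > 0"
  shows "\<exists>w. length w = n \<and> walk M A i w k"
  using assms(4,5)
proof (induction n arbitrary: k)
  case 0
  then show ?case using assms(1,3) by (auto split: if_splits)
next
  case (Suc n)
  have "(A ^\<^sub>m n * A) $$ (i, k) = (\<Sum>l<M. (A ^\<^sub>m n) $$ (i, l) * A $$ (l, k))"
    using A(1) assms(3) Suc.prems(1)
    by (auto simp: scalar_prod_def atLeast0LessThan intro!: sum.cong)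
  then have "(\<Sum>l<M. (A ^\<^sub>m n) $$ (i, l) * A $$ (l, k)) \<noteq> 0"
    using Suc.prems(2) unfolding pow_mat.simps by linarith
  then obtain l where "l < M" "(A ^\<^sub>m n) $$ (i, l) * A $$ (l, k) \<noteq> 0"
    by (rule sum.not_neutral_contains_not_neutral) auto
  then have l: "l < M" "(A ^\<^sub>m n) $$ (i, l) > 0" "A $$ (l, k) > 0" by auto
  have "A $$ (l, k) \<in> elements_mat A"
    using A(1) l(1) Suc.prems(1) by (intro elements_matI) auto
  then have "walk M A l [l] k" using A(2) l Suc.prems(1) by auto
  then show ?case
    using Suc.IH[OF l(1,2)] by (metis length_append_singleton walk_append)
qed

lemma irreducible_walk:
  assumes "A \<in> carrier_mat M M" "elements_mat A \<subseteq> {0, 1}" "irreducible_subshift M A"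
    and "i < M" "k < M"
  obtains w where "w \<noteq> []" "walk M A i w k"
proof -
  obtain n where "n > 0" "(A ^\<^sub>m n) $$ (i, k) > 0"
    using assms(3-5) unfolding irreducible_subshift_def by blast
  then obtain w where "length w = n" "walk M A i w k"
    using walk_of_positive_power_entry[OF assms(1,2,4,5)] by blast
  then show ?thesis using that \<open>n > 0\<close> by auto
qed

section \<open>Similarities indexed by words\<close>

primrec word_map :: "(nat \<Rightarrow> 'a \<Rightarrow> 'a) \<Rightarrow> nat list \<Rightarrow> 'a \<Rightarrow> 'a" where
  "word_map S [] = id"
| "word_map S (x # w) = S x \<circ> word_map S w"

definition word_ratio :: "(nat \<Rightarrow> real) \<Rightarrow> nat list \<Rightarrow> real" where
  "word_ratio r w = prod_list (map r w)"

definition word_rotation :: "(nat \<Rightarrow> real^'d^'d) \<Rightarrow> nat list \<Rightarrow> real^'d^'d" where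
  "word_rotation T w = foldr (**) (map T w) (mat 1)"

lemma word_map_append: "word_map S (u @ w) = word_map S u \<circ> word_map S w"
  by (induction u) (auto simp: fun_eq_iff)

lemma word_ratio_simps [simp]:
  "word_ratio r [] = 1" "word_ratio r (x # w) = r x * word_ratio r w"
  "word_ratio r (u @ w) = word_ratio r u * word_ratio r w"
  by (auto simp: word_ratio_def)

lemma word_rotation_simps [simp]:
  "word_rotation T [] = mat 1" "word_rotation T (x # w) = T x ** word_rotation T w"
  by (auto simp: word_rotation_def)

lemma word_rotation_append [simp]:
  "word_rotation T (u @ w) = word_rotation T u ** word_rotation T w"
  by (induction u) (auto simp: matrix_mul_assoc)

lemma prefix_comp_eq_word_map: "prefix_comp S \<alpha> n = word_map S (map \<alpha> [0..<n])"
  by (induction n) (auto simp: word_map_append)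

lemma word_map_eq_similarity:
  "word_map (sim_system r T v) w =
     similarity (word_ratio r w) (word_rotation T w) (word_map (sim_system r T v) w 0)"
proof (induction w)
  case Nil
  then show ?case by (simp add: similarity_def fun_eq_iff)
next
  case (Cons x w)
  show ?case
  proof
    fix y
    have *: "word_map (sim_system r T v) w y =
        word_ratio r w *\<^sub>R (word_rotation T w *v y) + word_map (sim_system r T v) w 0"
      by (subst Cons) (simp add: similarity_def)
    show "word_map (sim_system r T v) (x # w) y =
      similarity (word_ratio r (x # w)) (word_rotation T (x # w))
        (word_map (sim_system r T v) (x # w) 0) y"
      by (simp add: * sim_system_def similarity_def matrix_vector_right_distrib
          matrix_vector_mult_scaleR matrix_vector_mul_assoc scaleR_add_right)
  qed
qed

lemma dist_similarity:
  assumes "orthogonal_matrix Q" and "0 \<le> c"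
  shows "dist (similarity c Q u x) (similarity c Q u y) = c * dist x y"
proof -
  have "norm (Q *v (x - y)) = norm (x - y)"
    using assms(1) orthogonal_transformation_norm[of "(*v) Q"]
    by (simp add: orthogonal_transformation_matrix)
  then show ?thesis
    using assms(2) by (simp add: similarity_def dist_norm matrix_vector_mult_diff_distrib flip: scaleR_diff_right)
qed

lemma orthogonal_word_rotation:
  "(\<And>i. i \<in> set w \<Longrightarrow> orthogonal_matrix (T i)) \<Longrightarrow> orthogonal_matrix (word_rotation T w)"
  by (induction w) (auto intro: orthogonal_matrix_mul orthogonal_matrix_id)

locale sft_system =
  fixes M :: nat and A :: "nat mat"
    and r :: "nat \<Rightarrow> real" and T :: "nat \<Rightarrow> real^'d^'d" and v :: "nat \<Rightarrow> real^'d"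
  assumes contracting: "contracting_similarities M r T"
begin

abbreviation S where "S \<equiv> sim_system r T v"
abbreviation piece where "piece \<equiv> sft_attractor_at M A S"
abbreviation attr where "attr \<equiv> sft_attractor M A S"

lemma ratio_bounds: "i < M \<Longrightarrow> 0 < r i \<and> r i < 1"
  using contracting by (auto simp: contracting_similarities_def)

lemma word_ratio_pos: "set w \<subseteq> {..<M} \<Longrightarrow> 0 < word_ratio r w"
  by (induction w) (auto simp: ratio_bounds)

lemma word_ratio_less_1: "set w \<subseteq> {..<M} \<Longrightarrow> w \<noteq> [] \<Longrightarrow> word_ratio r w < 1"
proof (induction w)
  case (Cons x w)
  then have "word_ratio r w \<le> 1" by (cases "w = []") auto
  then have "r x * word_ratio r w \<le> r x"
    using Cons.prems ratio_bounds[of x] by (auto intro!: mult_left_le)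
  moreover have "r x < 1" using Cons.prems ratio_bounds[of x] by simp
  ultimately show ?case by simp
qed simp

lemma ratio_uniform_bound:
  obtains \<rho> where "0 < \<rho>" "\<rho> < 1" "\<And>i. i < M \<Longrightarrow> r i \<le> \<rho>"
proof (rule that)
  let ?X = "insert (1 / 2) (r ` {..<M})"
  show "0 < Max ?X" by (subst Max_gr_iff) auto
  show "Max ?X < 1" by (subst Max_less_iff) (auto simp: ratio_bounds)
  show "r i \<le> Max ?X" if "i < M" for i using that by (intro Max_ge) auto
qed

lemma word_ratio_le_power:
  assumes "\<And>i. i < M \<Longrightarrow> r i \<le> \<rho>" "0 < \<rho>" and "set w \<subseteq> {..<M}"
  shows "word_ratio r w \<le> \<rho> ^ length w"
  using assms(3)
proof (induction w)
  case (Cons x w)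
  then show ?case using assms(1)[of x] ratio_bounds[of x] word_ratio_pos[of w] assms(2)
    by (auto intro!: mult_mono)
qed simp

lemma orthogonal_word: "set w \<subseteq> {..<M} \<Longrightarrow> orthogonal_matrix (word_rotation T w)"
  using contracting by (auto simp: contracting_similarities_def intro!: orthogonal_word_rotation)

lemma dist_word_map:
  assumes "set w \<subseteq> {..<M}"
  shows "dist (word_map S w x) (word_map S w y) = word_ratio r w * dist x y"
  using dist_similarity[OF orthogonal_word[OF assms] less_imp_le[OF word_ratio_pos[OF assms]],
      of "word_map S w 0" x y]
  by (simp only: word_map_eq_similarity[symmetric])

lemma dist_letter_map: "i < M \<Longrightarrow> dist (S i x) (S i y) = r i * dist x y"
  using dist_word_map[of "[i]" x y] by simp

lemma inj_word_map: "set w \<subseteq> {..<M} \<Longrightarrow> inj (word_map S w)"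
  using dist_word_map[of w] word_ratio_pos[of w] by (intro injI) (metis dist_eq_0_iff mult_eq_0_iff order_less_irrefl)

lemma continuous_word_map: "set w \<subseteq> {..<M} \<Longrightarrow> continuous_on X (word_map S w)"
  by (rule lipschitz_on_continuous_on[of "word_ratio r w"], rule lipschitz_onI)
    (auto simp: dist_word_map intro: less_imp_le[OF word_ratio_pos])

lemma invariant_radius:
  obtains R where "0 < R" "\<And>w x. set w \<subseteq> {..<M} \<Longrightarrow> norm x \<le> R \<Longrightarrow> norm (word_map S w x) \<le> R"
proof -
  obtain \<rho> where \<rho>: "0 < \<rho>" "\<rho> < 1" "\<And>i. i < M \<Longrightarrow> r i \<le> \<rho>" using ratio_uniform_bound by blast
  define C where "C = Max (insert 1 ((\<lambda>i. norm (S i 0)) ` {..<M}))"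
  have C: "1 \<le> C" "\<And>i. i < M \<Longrightarrow> norm (S i 0) \<le> C" by (auto simp: C_def)
  have letter: "norm (S i x) \<le> C / (1 - \<rho>)" if i: "i < M" and x: "norm x \<le> C / (1 - \<rho>)" for i x
  proof -
    have "norm (S i x) \<le> dist (S i x) (S i 0) + norm (S i 0)"
      using norm_triangle_ineq[of "S i x - S i 0" "S i 0"] by (simp add: dist_norm)
    also have "\<dots> = r i * norm x + norm (S i 0)"
      using dist_letter_map[OF i, of x 0] by simp
    also have "\<dots> \<le> \<rho> * (C / (1 - \<rho>)) + C"
      using \<rho>(1) \<rho>(3)[OF i] x C(2)[OF i] by (intro add_mono mult_mono) auto
    also have "\<dots> = C / (1 - \<rho>)" using \<rho> by (simp add: field_simps)
    finally show ?thesis .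
  qed
  show ?thesis
  proof (rule that)
    show "0 < C / (1 - \<rho>)" using C(1) \<rho> by simp
    show "norm (word_map S w x) \<le> C / (1 - \<rho>)"
      if "set w \<subseteq> {..<M}" "norm x \<le> C / (1 - \<rho>)" for w x
      using that(1) by (induction w) (auto simp: that(2) letter)
  qed
qed

section \<open>The attractor of the subshift and its pieces\<close>

text \<open>A point that can be pulled back forever along \<open>\<alpha>\<close> without escaping to infinity is coded
  by \<open>\<alpha>\<close>, because the first \<open>n\<close> maps contract the bounded discrepancy to nothing.\<close>
lemma coding_map_eqI:
  assumes \<alpha>: "\<And>i. \<alpha> i < M" and x: "\<And>n. x = word_map S (map \<alpha> [0..<n]) (y n)"
    and y: "bounded (range y)"
  shows "coding_map S \<alpha> = x"
proof -
  obtain \<rho> where \<rho>: "0 < \<rho>" "\<rho> < 1" "\<And>i. i < M \<Longrightarrow> r i \<le> \<rho>" using ratio_uniform_bound by blast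
  obtain B where B: "0 < B" "\<And>n. norm (y n) \<le> B" using y by (auto simp: bounded_pos)
  have pre: "set (map \<alpha> [0..<n]) \<subseteq> {..<M}" for n using \<alpha> by auto
  have "dist (prefix_comp S \<alpha> n 0) x \<le> \<rho> ^ n * B" for n
  proof -
    have "dist (prefix_comp S \<alpha> n 0) x = word_ratio r (map \<alpha> [0..<n]) * norm (y n)"
      using dist_word_map[OF pre[of n], of 0 "y n"]
      by (subst x[of n]) (simp add: prefix_comp_eq_word_map)
    also have "\<dots> \<le> \<rho> ^ n * B"
      using word_ratio_le_power[OF \<rho>(3,1) pre[of n]] B \<rho>(1)
      by (intro mult_mono) auto
    finally show ?thesis .
  qed
  then have *: "\<forall>\<^sub>F n in sequentially. norm (dist (prefix_comp S \<alpha> n 0) x) \<le> \<rho> ^ n * B"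
    by (intro always_eventually) simp
  have "(\<lambda>n. \<rho> ^ n * B) \<longlonglongrightarrow> 0"
    using \<rho> by (intro tendsto_mult_left_zero LIMSEQ_realpow_zero) auto
  then have "(\<lambda>n. dist (prefix_comp S \<alpha> n 0) x) \<longlonglongrightarrow> 0"
    by (rule Lim_null_comparison[OF *])
  then have "(\<lambda>n. prefix_comp S \<alpha> n 0) \<longlonglongrightarrow> x" by (simp only: tendsto_dist_iff[symmetric])
  then show ?thesis unfolding coding_map_def by (rule limI)
qed

text \<open>
  Consecutive points of the sequence differ by at most a constant times \<open>\<rho> ^ n\<close>, so it is Cauchy.
\<close>
lemma coding_map_converges:
  assumes \<alpha>: "\<And>i. \<alpha> i < M"
  shows "(\<lambda>n. prefix_comp S \<alpha> n 0) \<longlonglongrightarrow> coding_map S \<alpha>"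
proof -
  let ?p = "\<lambda>n. prefix_comp S \<alpha> n 0"
  obtain \<rho> where \<rho>: "0 < \<rho>" "\<rho> < 1" "\<And>i. i < M \<Longrightarrow> r i \<le> \<rho>" using ratio_uniform_bound by blast
  obtain R where R: "0 < R" "\<And>w x. set w \<subseteq> {..<M} \<Longrightarrow> norm x \<le> R \<Longrightarrow> norm (word_map S w x) \<le> R"
    using invariant_radius by blast
  have pre: "set (map \<alpha> [0..<n]) \<subseteq> {..<M}" for n using \<alpha> by auto
  have step: "norm (?p (Suc n) - ?p n) \<le> \<rho> ^ n * R" for n
  proof -
    have "norm (?p (Suc n) - ?p n) = word_ratio r (map \<alpha> [0..<n]) * norm (S (\<alpha> n) 0)"
      using dist_word_map[OF pre[of n], of "S (\<alpha> n) 0" 0]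
      by (simp add: prefix_comp_eq_word_map dist_norm word_map_append)
    also have "\<dots> \<le> \<rho> ^ n * R"
      using word_ratio_le_power[OF \<rho>(3,1) pre[of n]] R(1) R(2)[of "[\<alpha> n]" 0] \<rho>(1) \<alpha>
      by (intro mult_mono) auto
    finally show ?thesis .
  qed
  have "summable (\<lambda>n. \<rho> ^ n * R)"
    using \<rho> by (intro summable_mult2 summable_geometric) auto
  then have "summable (\<lambda>n. ?p (Suc n) - ?p n)"
    by (rule summable_comparison_test'[of _ 0]) (rule step)
  then have "convergent (\<lambda>n. \<Sum>i<n. ?p (Suc i) - ?p i)"
    by (simp add: summable_iff_convergent)
  then have "convergent (\<lambda>n. ?p n - ?p 0)"
    using sum_lessThan_telescope[of ?p] by simp
  then have "convergent (\<lambda>n. (?p n - ?p 0) + ?p 0)"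
    by (intro convergent_add convergent_const)
  then have "convergent ?p" by (simp only: diff_add_cancel)
  then show ?thesis unfolding coding_map_def by (simp add: convergent_LIMSEQ_iff)
qed

lemma coding_map_shift:
  assumes \<alpha>: "\<And>i. \<alpha> i < M"
  shows "coding_map S \<alpha> = S (\<alpha> 0) (coding_map S (\<lambda>i. \<alpha> (Suc i)))"
proof -
  have "(\<lambda>n. S (\<alpha> 0) (prefix_comp S (\<lambda>i. \<alpha> (Suc i)) n 0)) \<longlonglongrightarrow>
      S (\<alpha> 0) (coding_map S (\<lambda>i. \<alpha> (Suc i)))"
    using continuous_word_map[of "[\<alpha> 0]" UNIV] \<alpha>
    by (intro continuous_on_tendsto_compose[OF _ coding_map_converges]) auto
  moreover have "prefix_comp S \<alpha> (Suc n) 0 = S (\<alpha> 0) (prefix_comp S (\<lambda>i. \<alpha> (Suc i)) n 0)" for n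
  proof -
    have "map \<alpha> [0..<Suc n] = \<alpha> 0 # map (\<lambda>i. \<alpha> (Suc i)) [0..<n]"
      by (subst map_upt_Suc) simp
    then show ?thesis unfolding prefix_comp_eq_word_map by simp
  qed
  ultimately have "(\<lambda>n. prefix_comp S \<alpha> (Suc n) 0) \<longlonglongrightarrow> S (\<alpha> 0) (coding_map S (\<lambda>i. \<alpha> (Suc i)))"
    by simp
  then show ?thesis
    by (rule LIMSEQ_unique[OF LIMSEQ_Suc[OF coding_map_converges[OF \<alpha>]]])
qed

lemma piece_recursion:
  assumes i: "i < M"
  shows "piece i = S i ` (\<Union>k\<in>{k. k < M \<and> A $$ (i, k) = 1}. piece k)"
proof (intro equalityI subsetI)
  fix x assume "x \<in> piece i"
  then obtain \<alpha> where a: "\<alpha> \<in> subshift M A" "\<alpha> 0 = i" "x = coding_map S \<alpha>"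
    by (auto simp: sft_attractor_at_def)
  have "(\<lambda>l. \<alpha> (Suc l)) \<in> subshift M A" using a(1) by (auto simp: subshift_def)
  then have "coding_map S (\<lambda>l. \<alpha> (Suc l)) \<in> piece (\<alpha> 1)"
    by (auto simp: sft_attractor_at_def)
  moreover have "x = S i (coding_map S (\<lambda>l. \<alpha> (Suc l)))"
    using coding_map_shift[of \<alpha>] a by (auto simp: subshift_def)
  moreover have "\<alpha> 1 < M" "A $$ (i, \<alpha> 1) = 1" using a by (auto simp: subshift_def)
  ultimately show "x \<in> S i ` (\<Union>k\<in>{k. k < M \<and> A $$ (i, k) = 1}. piece k)" by blast
next
  fix x assume "x \<in> S i ` (\<Union>k\<in>{k. k < M \<and> A $$ (i, k) = 1}. piece k)"
  then obtain k \<beta> where b: "k < M" "A $$ (i, k) = 1" "\<beta> \<in> subshift M A" "\<beta> 0 = k"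
    "x = S i (coding_map S \<beta>)"
    by (auto simp: sft_attractor_at_def)
  define \<alpha> where "\<alpha> n = (case n of 0 \<Rightarrow> i | Suc l \<Rightarrow> \<beta> l)" for n
  have "\<alpha> \<in> subshift M A" using b i by (auto simp: subshift_def \<alpha>_def split: nat.splits)
  moreover have "coding_map S \<alpha> = x"
    using coding_map_shift[of \<alpha>] calculation b by (simp add: subshift_def \<alpha>_def)
  ultimately show "x \<in> piece i" by (force simp: sft_attractor_at_def \<alpha>_def)
qed

lemma word_map_piece_subset: "walk M A i w k \<Longrightarrow> word_map S w ` piece k \<subseteq> piece i"
proof (induction w arbitrary: i)
  case (Cons x w)
  from Cons.prems obtain l where l: "x = i" "i < M" "l < M" "A $$ (i, l) = 1" "walk M A l w k"
    by auto
  have "word_map S (x # w) ` piece k = S i ` word_map S w ` piece k"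
    using l(1) by (simp add: image_comp)
  also have "\<dots> \<subseteq> S i ` piece l" using Cons.IH[OF l(5)] by blast
  also have "\<dots> \<subseteq> piece i" using piece_recursion[OF l(2)] l by blast
  finally show ?case .
qed simp

lemma piece_decomposition:
  assumes "i < M" "x \<in> piece i"
  obtains w k where "length w = n" "k < M" "walk M A i w k" "x \<in> word_map S w ` piece k"
proof -
  have "\<exists>w k. length w = n \<and> k < M \<and> walk M A i w k \<and> x \<in> word_map S w ` piece k"
    using assms
  proof (induction n arbitrary: i x)
    case 0
    then show ?case by (intro exI[of _ "[]"] exI[of _ i]) simp
  next
    case (Suc n)
    obtain l y where l: "l < M" "A $$ (i, l) = 1" "y \<in> piece l" "x = S i y"
      using piece_recursion[OF Suc.prems(1)] Suc.prems(2) by auto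
    obtain w k where w: "length w = n" "k < M" "walk M A l w k" "y \<in> word_map S w ` piece k"
      using Suc.IH[OF l(1,3)] by blast
    have "x \<in> word_map S (i # w) ` piece k" using w(4) l(4) by auto
    moreover have "walk M A i (i # w) k" using l w Suc.prems by auto
    ultimately show ?case using w(1,2) by (intro exI[of _ "i # w"] exI[of _ k]) simp
  qed
  then show ?thesis using that by blast
qed

lemma attr_eq_pieces: "attr = (\<Union>i<M. piece i)"
  by (auto simp: sft_attractor_def sft_attractor_at_def subshift_def)

lemma attr_bounded:
  obtains R where "0 < R" "attr \<subseteq> ball 0 R"
proof -
  obtain R where R: "0 < R" "\<And>w x. set w \<subseteq> {..<M} \<Longrightarrow> norm x \<le> R \<Longrightarrow> norm (word_map S w x) \<le> R"
    using invariant_radius by blast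
  have "norm (coding_map S \<alpha>) \<le> R" if "\<alpha> \<in> subshift M A" for \<alpha>
  proof -
    have \<alpha>: "\<And>i. \<alpha> i < M" using that by (auto simp: subshift_def)
    have pre: "set (map \<alpha> [0..<n]) \<subseteq> {..<M}" for n using \<alpha> by auto
    have "norm (prefix_comp S \<alpha> n 0) \<le> R" for n
      using R(1) R(2)[OF pre[of n], of 0]
      by (simp add: prefix_comp_eq_word_map)
    then show ?thesis
      by (intro Lim_norm_ubound[OF _ coding_map_converges[OF \<alpha>]]) auto
  qed
  then have "norm x \<le> R" if "x \<in> attr" for x using that unfolding sft_attractor_def by blast
  then have "attr \<subseteq> ball 0 (R + 1)" by (force simp: subset_iff)
  then show ?thesis using that[of "R + 1"] R(1) by simp
qed

lemma piece_subset_attr: "piece i \<subseteq> attr"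
  by (auto simp: sft_attractor_def sft_attractor_at_def)

lemma bounded_piece: "bounded (piece i)"
  by (rule attr_bounded) (meson bounded_ball bounded_subset piece_subset_attr order_trans)

text \<open>The closures of the pieces solve the same recursion as the pieces. Following the recursion
  from a point of a closure reads off an admissible sequence that codes it, so the pieces were
  closed already.\<close>
lemma compact_piece:
  assumes i: "i < M"
  shows "compact (piece i)"
proof -
  let ?E = "\<lambda>i. closure (piece i)"
  have rec: "\<exists>k y. k < M \<and> A $$ (i, k) = 1 \<and> y \<in> ?E k \<and> x = S i y" if i: "i < M" and x: "x \<in> ?E i" for i x
  proof -
    let ?N = "{k. k < M \<and> A $$ (i, k) = 1}"
    have c: "compact (S i ` (\<Union>k\<in>?N. ?E k))"
      using continuous_word_map[of "[i]"] i bounded_piece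
      by (intro compact_continuous_image compact_UN) (auto simp: compact_closure)
    have "?E i \<subseteq> S i ` (\<Union>k\<in>?N. ?E k)"
    proof (rule closure_minimal[OF _ compact_imp_closed[OF c]])
      show "piece i \<subseteq> S i ` (\<Union>k\<in>?N. ?E k)"
        by (subst piece_recursion[OF i]) (intro image_mono UN_mono closure_subset subset_refl)
    qed
    then show ?thesis using x by blast
  qed
  have "?E i \<subseteq> piece i"
  proof
    fix x assume x: "x \<in> ?E i"
    define Q where "Q n p \<longleftrightarrow> fst p < M \<and> snd p \<in> ?E (fst p) \<and> (n = 0 \<longrightarrow> p = (i, x))" for n :: nat and p
    define Z where "Z p q \<longleftrightarrow> A $$ (fst p, fst q) = 1 \<and> snd p = S (fst p) (snd q)" for p q
    have "\<exists>f. \<forall>n. Q n (f n) \<and> Z (f n) (f (Suc n))"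
    proof (rule dependent_nat_choice)
      show "\<exists>p. Q 0 p" using i x by (auto simp: Q_def)
      show "\<exists>q. Q (Suc n) q \<and> Z p q" if "Q n p" for p n
        using rec[of "fst p" "snd p"] that by (auto simp: Q_def Z_def)
    qed
    then obtain f where f: "\<And>n. Q n (f n)" "\<And>n. Z (f n) (f (Suc n))" by blast
    define \<alpha> where "\<alpha> n = fst (f n)" for n
    have \<alpha>: "\<alpha> n < M" for n using f(1)[of n] by (auto simp: Q_def \<alpha>_def)
    have "\<alpha> \<in> subshift M A" using f(2) \<alpha> by (auto simp: subshift_def Z_def \<alpha>_def)
    have fx: "x = word_map S (map \<alpha> [0..<n]) (snd (f n))" for n
    proof (induction n)
      case 0
      then show ?case using f(1)[of 0] by (simp add: Q_def)
    next
      case (Suc n)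
      then show ?case using f(2)[of n] by (simp add: word_map_append Z_def \<alpha>_def)
    qed
    have "snd (f n) \<in> closure attr" for n
      using f(1)[of n] closure_mono[OF piece_subset_attr] unfolding Q_def by blast
    then have "range (\<lambda>n. snd (f n)) \<subseteq> closure attr" by blast
    moreover have "bounded (closure attr)"
      using attr_bounded bounded_subset[OF bounded_ball] bounded_closure by blast
    ultimately have "bounded (range (\<lambda>n. snd (f n)))"
      using bounded_subset by blast
    then have "coding_map S \<alpha> = x" using coding_map_eqI[OF \<alpha> fx] by simp
    moreover have "\<alpha> 0 = i" using f(1)[of 0] by (simp add: Q_def \<alpha>_def)
    ultimately show "x \<in> piece i"
      using \<open>\<alpha> \<in> subshift M A\<close> by (auto simp: sft_attractor_at_def)
  qed
  then have "?E i = piece i" using closure_subset by blast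
  then show ?thesis using bounded_piece[of i] compact_closure[of "piece i"] by simp
qed

end

section \<open>Attractors inside an invariant compact set\<close>

text \<open>
  The attractor is the decreasing intersection of the iterated images of the invariant set. Taking the
  given compact set as the starting point is what places the attractor inside it. The
  inclusion of \<open>K\<close> in the union of its images needs one index that works at all levels: if every index
  failed at some level, all would fail at the largest of these levels.
\<close>
lemma attractor_in_invariant_compact:
  fixes f :: "nat \<Rightarrow> 'a::euclidean_space \<Rightarrow> 'a"
  assumes X: "compact X" "X \<noteq> {}" and m: "0 < m"
    and cont: "\<And>k. k < m \<Longrightarrow> continuous_on UNIV (f k)"
    and inj: "\<And>k. k < m \<Longrightarrow> inj (f k)"
    and inv: "\<And>k. k < m \<Longrightarrow> f k ` X \<subseteq> X"
  obtains K where "K \<subseteq> X" "ifs_attractor m f K"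
proof -
  define \<Phi> where "\<Phi> E = (\<Union>k<m. f k ` E)" for E
  define X' where "X' n = (\<Phi> ^^ n) X" for n
  have X'0: "X' 0 = X" and X'S: "X' (Suc n) = (\<Union>k<m. f k ` X' n)" for n
    by (auto simp: X'_def \<Phi>_def)
  have comp: "compact (X' n)" for n
  proof (induction n)
    case (Suc n)
    have "compact (f k ` X' n)" if "k < m" for k
      using compact_continuous_image[OF continuous_on_subset[OF cont[OF that] subset_UNIV] Suc] .
    then show ?case unfolding X'S by (intro compact_UN) auto
  qed (simp add: X'0 X)
  have ne: "X' n \<noteq> {}" for n
    using m X(2) by (induction n) (auto simp: X'0 X'S)
  have step: "X' (Suc n) \<subseteq> X' n" for n
  proof (induction n)
    case 0
    show ?case using inv unfolding X'S X'0 by blast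
  next
    case (Suc n)
    show ?case unfolding X'S[of "Suc n"] by (subst X'S[of n]) (use Suc in blast)
  qed
  have mono: "X' n \<subseteq> X' l" if "l \<le> n" for l n
    using lift_Suc_antimono_le[of X', OF step that] .
  define K where "K = \<Inter> (range X')"
  have "K \<noteq> {}" unfolding K_def using compact_nest[OF comp ne mono] .
  moreover have "compact K"
    unfolding K_def using comp by (intro compact_Inter) auto
  moreover have "f k ` K \<subseteq> K" if "k < m" for k
  proof -
    have "f k ` K \<subseteq> X' (Suc n)" for n unfolding X'S using that by (auto simp: K_def)
    then show ?thesis using step unfolding K_def by blast
  qed
  moreover have "K \<subseteq> (\<Union>k<m. f k ` K)"
  proof
    fix x assume x: "x \<in> K"
    have "\<exists>k<m. \<forall>n. x \<in> f k ` X' n"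
    proof (rule ccontr)
      assume "\<not> ?thesis"
      then obtain n where n: "\<And>k. k < m \<Longrightarrow> x \<notin> f k ` X' (n k)" by metis
      define N where "N = Max (n ` {..<m})"
      have "n k \<le> N" if "k < m" for k using that by (auto simp: N_def)
      then have "x \<notin> f k ` X' N" if "k < m" for k using n[OF that] mono that by blast
      then have "x \<notin> X' (Suc N)" unfolding X'S by blast
      then show False using x by (auto simp: K_def)
    qed
    then obtain k where k: "k < m" "\<And>n. x \<in> f k ` X' n" by blast
    obtain y where y: "x = f k y" using k(2)[of 0] by auto
    have "y \<in> X' n" for n using k(2)[of n] injD[OF inj[OF k(1)]] y by blast
    then show "x \<in> (\<Union>k<m. f k ` K)" using k(1) y by (auto simp: K_def)
  qed
  ultimately have "ifs_attractor m f K" unfolding ifs_attractor_def by blast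
  moreover have "K \<subseteq> X" using X'0 by (auto simp: K_def)
  ultimately show ?thesis using that by blast
qed

section \<open>The orthogonal group and rotations of loops\<close>

lemma orthogonal_group_simps:
  "carrier orthogonal_group = {Q. orthogonal_matrix Q}"
  "P \<otimes>\<^bsub>orthogonal_group\<^esub> Q = P ** Q"
  "\<one>\<^bsub>orthogonal_group\<^esub> = mat 1"
  by (simp_all add: orthogonal_group_def)

lemma group_orthogonal_group: "group (orthogonal_group :: (real^'d^'d) monoid)"
proof (rule groupI, unfold orthogonal_group_simps mem_Collect_eq)
  show "orthogonal_matrix (P ** Q)" if "orthogonal_matrix P" "orthogonal_matrix Q"
    for P Q :: "real^'d^'d"
    using orthogonal_matrix_mul[OF that] .
  show "\<exists>P\<in>{Q. orthogonal_matrix Q}. P ** Q = mat 1" if "orthogonal_matrix Q" for Q :: "real^'d^'d"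
    using that by (intro bexI[of _ "transpose Q"]) (auto simp: orthogonal_matrix_def)
qed (auto simp: matrix_mul_assoc orthogonal_matrix_id)

lemma inv_orthogonal_group:
  fixes Q :: "real^'d^'d"
  assumes "orthogonal_matrix Q"
  shows "inv\<^bsub>orthogonal_group\<^esub> Q = transpose Q"
  using assms by (intro group.inv_equality[OF group_orthogonal_group])
    (auto simp: orthogonal_group_simps orthogonal_matrix_def)

lemma subgroup_orthogonal_closed:
  assumes "subgroup H (orthogonal_group :: (real^'d^'d) monoid)"
  shows "mat 1 \<in> H"
    and "\<And>P Q. P \<in> H \<Longrightarrow> Q \<in> H \<Longrightarrow> P ** Q \<in> H"
    and "\<And>P. P \<in> H \<Longrightarrow> transpose P \<in> H"
    and "\<And>P. P \<in> H \<Longrightarrow> orthogonal_matrix P"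
proof -
  show o: "orthogonal_matrix P" if "P \<in> H" for P
    using subgroup.mem_carrier[OF assms that] by (simp add: orthogonal_group_simps)
  show "mat 1 \<in> H" using subgroup.one_closed[OF assms] by (simp add: orthogonal_group_simps)
  show "P ** Q \<in> H" if "P \<in> H" "Q \<in> H" for P Q
    using subgroup.m_closed[OF assms that] by (simp add: orthogonal_group_simps)
  show "transpose P \<in> H" if "P \<in> H" for P
    using subgroup.m_inv_closed[OF assms that] inv_orthogonal_group[OF o[OF that]] by simp
qed

lemma orthogonal_cancel:
  fixes P Q :: "real^'d^'d"
  assumes "orthogonal_matrix P"
  shows "transpose P ** (P ** Q) = Q" "P ** (transpose P ** Q) = Q"
  using assms by (simp_all add: matrix_mul_assoc orthogonal_matrix_def)

context sft_system
begin

text \<open>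
  The rotations of all loops at \<open>j\<close> are generated by those of finitely many loops, as for the fundamental
  group of a finite graph. Fix a walk \<open>p a\<close> back to \<open>j\<close> and a walk \<open>q a\<close> from \<open>j\<close> for every vertex, and write
  \<open>R\<close> for the rotation of a word. Along a loop the rotation telescopes into factors
  \<open>R(p a)\<^sup>-\<^sup>1 T\<^sub>a R(p b)\<close>, one for each edge \<open>(a, b)\<close>, and such a factor is
  \<open>R(q a p a)\<^sup>-\<^sup>1 R(q a a p b)\<close>, a quotient of rotations of loops.
\<close>
lemma loop_rotations_generated:
  assumes j: "j < M"
    and p: "\<And>a. a < M \<Longrightarrow> walk M A a (p a) j"
    and q: "\<And>a. a < M \<Longrightarrow> walk M A j (q a) a"
    and H: "subgroup H orthogonal_group"
    and gen: "word_rotation T (p j) \<in> H" "\<And>a. a < M \<Longrightarrow> word_rotation T (q a @ p a) \<in> H"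
      "\<And>a b. a < M \<Longrightarrow> b < M \<Longrightarrow> A $$ (a, b) = 1 \<Longrightarrow> word_rotation T (q a @ a # p b) \<in> H"
    and w: "walk M A j w j"
  shows "word_rotation T w \<in> H"
proof -
  let ?R = "word_rotation T"
  note cl = subgroup_orthogonal_closed[OF H]
  have op: "orthogonal_matrix (?R (p a))" and oq: "orthogonal_matrix (?R (q a))" if "a < M" for a
    using orthogonal_word[OF walk_letters] p[OF that] q[OF that] by blast+
  have "transpose (?R (p i)) ** ?R w \<in> H" if "walk M A i w j" for i w
    using that
  proof (induction w arbitrary: i)
    case Nil
    then show ?case using gen(1) cl(3) by simp
  next
    case (Cons x w)
    from Cons.prems obtain l where l: "x = i" "i < M" "l < M" "A $$ (i, l) = 1" "walk M A l w j"
      by auto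
    have "transpose (?R (q i @ p i)) ** ?R (q i @ i # p l) \<in> H"
      using cl(2)[OF cl(3)[OF gen(2)] gen(3)] l by blast
    also have "transpose (?R (q i @ p i)) ** ?R (q i @ i # p l) =
        transpose (?R (p i)) ** (T i ** ?R (p l))"
      by (simp add: matrix_transpose_mul orthogonal_cancel[OF oq[OF l(2)]] flip: matrix_mul_assoc)
    finally have "transpose (?R (p i)) ** (T i ** ?R (p l)) ** (transpose (?R (p l)) ** ?R w) \<in> H"
      using cl(2) Cons.IH[OF l(5)] by blast
    then show ?case
      by (simp add: l(1) orthogonal_cancel[OF op[OF l(3)]] flip: matrix_mul_assoc)
  qed
  from cl(2)[OF gen(1) this[OF w]] show ?thesis
    by (simp add: orthogonal_cancel[OF op[OF j]])
qed

section \<open>Disjoint cylinders\<close>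

lemma attr_cylinder_cover:
  assumes "x \<in> attr"
  obtains w i k where "length w = n" "i < M" "k < M" "walk M A i w k" "x \<in> word_map S w ` attr"
proof -
  obtain i where i: "i < M" "x \<in> piece i" using assms by (auto simp: attr_eq_pieces)
  obtain w k where w: "length w = n" "k < M" "walk M A i w k" "x \<in> word_map S w ` piece k"
    using piece_decomposition[OF i] by blast
  then have "x \<in> word_map S w ` attr" using piece_subset_attr by blast
  then show ?thesis using that w i by blast
qed

text \<open>
  Words of equal length can have very different ratios, so their cylinders are thinned out by Vitali
  covering rather than by scale. The selected balls, enlarged five times, cover the attractor, and
  positivity of the measure at \<open>t'\<close> bounds the sum of the \<open>t'\<close>-th powers from below. Passing to the
  smaller exponent \<open>t\<close> multiplies each term by at least \<open>\<rho> powr (- n * (t' - t))\<close>, which is unbounded as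
  the length \<open>n\<close> grows.
\<close>
lemma disjoint_cylinders_large_sum:
  assumes pos: "hausdorff_measure t' attr \<noteq> 0" and t: "0 \<le> t" "t < t'" and B: "0 < B"
  obtains n D where "0 < n" "finite D"
    "\<And>w. w \<in> D \<Longrightarrow> length w = n \<and> (\<exists>i<M. \<exists>k<M. walk M A i w k)"
    "\<And>u w. u \<in> D \<Longrightarrow> w \<in> D \<Longrightarrow> u \<noteq> w \<Longrightarrow> word_map S u ` attr \<inter> word_map S w ` attr = {}"
    "B \<le> (\<Sum>w\<in>D. word_ratio r w powr t)"
proof -
  obtain \<delta> where \<delta>: "0 < \<delta>" "hausdorff_premeasure t' \<delta> attr \<noteq> 0"
    using hausdorff_measure_pos_imp_premeasure_pos[OF pos] .
  \<comment> \<open>The premeasure may be infinite, so a positive real lower bound is extracted.\<close>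
  define e where "e = enn2real (min 1 (hausdorff_premeasure t' \<delta> attr))"
  have e: "0 < e" "ennreal e \<le> hausdorff_premeasure t' \<delta> attr"
    using \<delta>(2) by (auto simp: e_def enn2real_positive_iff min_less_iff_disj ennreal_enn2real_if
        zero_less_iff_neq_zero)
  obtain R where R: "0 < R" "attr \<subseteq> ball 0 R" using attr_bounded .
  obtain \<rho> where \<rho>: "0 < \<rho>" "\<rho> < 1" "\<And>i. i < M \<Longrightarrow> r i \<le> \<rho>" using ratio_uniform_bound by blast
  define q where "q = \<rho> powr (t' - t)"
  have q: "0 < q" "q < 1" using \<rho> t powr_less_mono2[of "t' - t" \<rho> 1] by (auto simp: q_def)
  have "(\<lambda>n. 10 * R * \<rho> ^ n) \<longlonglongrightarrow> 0"
    using \<rho> by (intro tendsto_mult_right_zero LIMSEQ_realpow_zero) auto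
  then have ev1: "\<forall>\<^sub>F n in sequentially. 10 * R * \<rho> ^ n < \<delta>"
    using \<delta>(1) by (rule order_tendstoD)
  have "(\<lambda>n. ((10 * R) powr t' * B) * q ^ n) \<longlonglongrightarrow> 0"
    using q by (intro tendsto_mult_right_zero LIMSEQ_realpow_zero) auto
  then have ev2: "\<forall>\<^sub>F n in sequentially. ((10 * R) powr t' * B) * q ^ n < e"
    using e(1) by (rule order_tendstoD)
  have "\<exists>n. 10 * R * \<rho> ^ n < \<delta> \<and> ((10 * R) powr t' * B) * q ^ n < e \<and> 1 \<le> n"
    using eventually_conj[OF ev1 eventually_conj[OF ev2 eventually_ge_at_top[of 1]]]
    by (rule eventually_happens'[OF sequentially_bot])
  then obtain n where n: "10 * R * \<rho> ^ n < \<delta>" "((10 * R) powr t' * B) * q ^ n < e" "0 < n"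
    by auto
  define W where "W = {w. length w = n \<and> (\<exists>i<M. \<exists>k<M. walk M A i w k)}"
  have letters: "set w \<subseteq> {..<M}" if "w \<in> W" for w using that walk_letters unfolding W_def by blast
  have "finite W"
  proof (rule finite_subset)
    show "W \<subseteq> {w. set w \<subseteq> {..<M} \<and> length w = n}" using letters unfolding W_def by blast
  qed (rule finite_lists_length_eq, simp)
  have ratio: "0 < word_ratio r w" "word_ratio r w \<le> \<rho> ^ n" if "w \<in> W" for w
    using word_ratio_pos[OF letters[OF that]] word_ratio_le_power[OF \<rho>(3,1) letters[OF that]] that
    by (auto simp: W_def)
  have cyl: "word_map S w ` attr \<subseteq> ball (word_map S w 0) (word_ratio r w * R)" if "w \<in> W" for w
    using R(2) ratio[OF that] dist_word_map[OF letters[OF that], of 0] by (auto simp: subset_iff)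
  have "attr \<subseteq> (\<Union>w\<in>W. ball (word_map S w 0) (word_ratio r w * R))"
  proof
    fix x assume "x \<in> attr"
    then obtain w i k where w: "length w = n" "i < M" "k < M" "walk M A i w k"
        "x \<in> word_map S w ` attr"
      by (rule attr_cylinder_cover)
    then have "w \<in> W" unfolding W_def by blast
    then show "x \<in> (\<Union>w\<in>W. ball (word_map S w 0) (word_ratio r w * R))"
      using cyl w(5) by blast
  qed
  moreover have "0 < word_ratio r w * R \<and> word_ratio r w * R \<le> \<rho> ^ n * R" if "w \<in> W" for w
    using ratio[OF that] R(1) by auto
  ultimately obtain D where D: "D \<subseteq> W"
    "pairwise (\<lambda>u w. disjnt (ball (word_map S u 0) (word_ratio r u * R))
                         (ball (word_map S w 0) (word_ratio r w * R))) D"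
    "attr \<subseteq> (\<Union>w\<in>D. ball (word_map S w 0) (5 * (word_ratio r w * R)))"
    by (rule Vitali_covering_lemma_balls)
  have "finite D" using D(1) \<open>finite W\<close> finite_subset by blast
  have "B \<le> (\<Sum>w\<in>D. word_ratio r w powr t)"
  proof (rule ccontr)
    assume neg: "\<not> ?thesis"
    have "ennreal e \<le> hausdorff_premeasure t' \<delta> attr" by (rule e(2))
    also have "\<dots> \<le> (\<Sum>w\<in>D. hausdorff_gauge t' (ball (word_map S w 0) (5 * (word_ratio r w * R))))"
    proof (rule hausdorff_premeasure_finite_cover[OF \<open>finite D\<close> D(3)])
      fix w assume "w \<in> D"
      then have "10 * (word_ratio r w * R) \<le> 10 * R * \<rho> ^ n" "0 < word_ratio r w * R"
        using ratio[of w] R(1) D(1) by auto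
      then show "bounded (ball (word_map S w 0) (5 * (word_ratio r w * R))) \<and>
        diameter (ball (word_map S w 0) (5 * (word_ratio r w * R))) \<le> \<delta>"
        using n(1) by auto
    qed (use \<delta> in auto)
    also have "\<dots> = (\<Sum>w\<in>D. ennreal ((10 * R) powr t' * word_ratio r w powr t'))"
    proof (rule sum.cong[OF refl])
      fix w assume "w \<in> D"
      then have "0 < word_ratio r w" using ratio D(1) by auto
      then have "diameter (ball (word_map S w 0) (5 * (word_ratio r w * R))) = (10 * R) * word_ratio r w"
        using R(1) by (auto simp: not_less[symmetric] mult_less_0_iff)
      then show "hausdorff_gauge t' (ball (word_map S w 0) (5 * (word_ratio r w * R))) =
          ennreal ((10 * R) powr t' * word_ratio r w powr t')"
        using t R(1) \<open>0 < word_ratio r w\<close> by (simp add: hausdorff_gauge_powr powr_mult)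
    qed
    also have "\<dots> = ennreal (\<Sum>w\<in>D. (10 * R) powr t' * word_ratio r w powr t')"
      by (simp add: sum_ennreal)
    finally have "e \<le> (\<Sum>w\<in>D. (10 * R) powr t' * word_ratio r w powr t')"
      by (subst (asm) ennreal_le_iff) (auto intro!: sum_nonneg)
    also have "\<dots> \<le> (\<Sum>w\<in>D. (10 * R) powr t' * (word_ratio r w powr t * q ^ n))"
    proof (intro sum_mono mult_left_mono)
      fix w assume "w \<in> D"
      then have w: "0 < word_ratio r w" "word_ratio r w \<le> \<rho> ^ n" using ratio D(1) by auto
      have "word_ratio r w powr t' = word_ratio r w powr t * word_ratio r w powr (t' - t)"
        by (simp flip: powr_add)
      also have "word_ratio r w powr (t' - t) \<le> (\<rho> ^ n) powr (t' - t)"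
        using w t by (intro powr_mono2) auto
      also have "(\<rho> ^ n) powr (t' - t) = q ^ n"
        using \<rho>(1) by (simp add: q_def powr_powr mult.commute flip: powr_realpow)
      finally show "word_ratio r w powr t' \<le> word_ratio r w powr t * q ^ n"
        by (simp add: mult_left_mono)
    qed auto
    also have "\<dots> = ((10 * R) powr t' * (\<Sum>w\<in>D. word_ratio r w powr t)) * q ^ n"
      by (simp add: sum_distrib_left sum_distrib_right mult_ac)
    also have "\<dots> \<le> ((10 * R) powr t' * B) * q ^ n"
      using neg q(1) by (intro mult_right_mono mult_left_mono) auto
    finally show False using n(2) by simp
  qed
  moreover have "word_map S u ` attr \<inter> word_map S w ` attr = {}" if "u \<in> D" "w \<in> D" "u \<noteq> w" for u w
  proof -
    have "disjnt (ball (word_map S u 0) (word_ratio r u * R)) (ball (word_map S w 0) (word_ratio r w * R))"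
      using D(2) that unfolding pairwise_def by blast
    then show ?thesis using cyl[of u] cyl[of w] that D(1) unfolding disjnt_def by blast
  qed
  ultimately show ?thesis
    using that[of n D] n(3) \<open>finite D\<close> D(1) unfolding W_def by blast
qed

text \<open>
  For a large exponent the sum over all words of length \<open>n\<close> is at most 1, whereas infinite dimension
  would make it exceed any bound on suitable subfamilies.
\<close>
lemma hausdorff_dim_attr_finite: "hausdorff_dim attr < \<infinity>"
proof (rule ccontr)
  assume "\<not> ?thesis"
  then have inf: "ereal s < hausdorff_dim attr" for s by auto
  obtain \<rho> where \<rho>: "0 < \<rho>" "\<rho> < 1" "\<And>i. i < M \<Longrightarrow> r i \<le> \<rho>" using ratio_uniform_bound by blast
  obtain N where N: "\<rho> ^ N < 1 / (real M + 1)"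
    using real_arch_pow_inv[of "1 / (real M + 1)" \<rho>] \<rho> by auto
  have MN: "real M * \<rho> ^ N \<le> 1"
  proof -
    have "real M * \<rho> ^ N \<le> (real M + 1) * (1 / (real M + 1))"
      using N \<rho>(1) by (intro mult_mono) auto
    then show ?thesis by simp
  qed
  have pos: "hausdorff_measure (real N + 1) attr \<noteq> 0"
    by (rule hausdorff_measure_nonzero_below_dim[OF _ inf]) simp
  have N': "0 \<le> real N" "real N < real N + 1" "(0::real) < 2" by auto
  obtain n D where D: "finite D" "\<And>w. w \<in> D \<Longrightarrow> length w = n \<and> (\<exists>i<M. \<exists>k<M. walk M A i w k)"
    "2 \<le> (\<Sum>w\<in>D. word_ratio r w powr real N)"
    by (rule disjoint_cylinders_large_sum[OF pos N']) blast
  have sub: "D \<subseteq> {w. set w \<subseteq> {..<M} \<and> length w = n}" using D(2) walk_letters by blast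
  have "(\<Sum>w\<in>D. word_ratio r w powr real N) \<le> (\<Sum>w\<in>D. (\<rho> ^ n) ^ N)"
  proof (rule sum_mono)
    fix w assume "w \<in> D"
    then have w: "set w \<subseteq> {..<M}" "length w = n" using sub by auto
    then show "word_ratio r w powr real N \<le> (\<rho> ^ n) ^ N"
      using word_ratio_pos[OF w(1)] word_ratio_le_power[OF \<rho>(3,1) w(1)]
      by (simp add: powr_realpow power_mono)
  qed
  also have "\<dots> = real (card D) * (\<rho> ^ N) ^ n"
    by (simp add: power_mult[symmetric] mult.commute)
  also have "\<dots> \<le> real (M ^ n) * (\<rho> ^ N) ^ n"
    using card_mono[OF finite_lists_length_eq sub] \<rho>(1)
    by (intro mult_right_mono) (auto simp: card_lists_length_eq)
  also have "\<dots> = (real M * \<rho> ^ N) ^ n" by (simp add: power_mult_distrib)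
  also have "\<dots> \<le> 1" using MN \<rho>(1) by (intro power_le_one) auto
  finally show False using D(3) by simp
qed

end

section \<open>Tagging loops so that their pieces become disjoint\<close>

text \<open>
  The word \<open>a\<^sup>k b x\<close>. If \<open>a\<close> and \<open>b\<close> are loops with disjoint cylinders, then \<open>a\<^sup>k b\<close> is a prefix code
  in \<open>k\<close>, so \<open>k\<close> serves as a tag that keeps arbitrary tails \<open>x\<close> apart.
\<close>
definition tagged :: "nat list \<Rightarrow> nat list \<Rightarrow> nat \<Rightarrow> nat list \<Rightarrow> nat list" where
  "tagged a b k x = concat (replicate k a) @ b @ x"

context sft_system
begin

lemma image_append_disjoint:
  assumes "set u \<subseteq> {..<M}" and "word_map S x ` X \<inter> word_map S y ` Y = {}"
  shows "word_map S (u @ x) ` X \<inter> word_map S (u @ y) ` Y = {}"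
proof -
  have "word_map S (u @ x) ` X \<inter> word_map S (u @ y) ` Y =
      word_map S u ` (word_map S x ` X \<inter> word_map S y ` Y)"
    using image_Int[OF inj_word_map[OF assms(1)]] by (simp add: word_map_append image_comp)
  then show ?thesis using assms(2) by simp
qed

text \<open>
  Two distinct points of a piece lie in cylinders that are too small to meet; both cylinders are entered
  from \<open>j\<close> along the same walk and left along walks that return to \<open>j\<close>.
\<close>
lemma two_disjoint_loops:
  assumes conn: "\<And>a b. a < M \<Longrightarrow> b < M \<Longrightarrow> \<exists>w. w \<noteq> [] \<and> walk M A a w b"
    and j: "j < M" and i: "i < M" and xy: "x \<in> piece i" "y \<in> piece i" "x \<noteq> y"
  obtains a b where "walk M A j a j" "walk M A j b j" "a \<noteq> []" "b \<noteq> []"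
    "word_map S a ` piece j \<inter> word_map S b ` piece j = {}"
proof -
  obtain R where R: "0 < R" "attr \<subseteq> ball 0 R" using attr_bounded .
  obtain \<rho> where \<rho>: "0 < \<rho>" "\<rho> < 1" "\<And>i. i < M \<Longrightarrow> r i \<le> \<rho>" using ratio_uniform_bound by blast
  obtain n where n: "\<rho> ^ n < dist x y / (4 * R)"
    using real_arch_pow_inv[of "dist x y / (4 * R)" \<rho>] \<rho> R(1) xy(3) by auto
  have diam: "dist z z' \<le> \<rho> ^ n * (2 * R)"
    if w: "set w \<subseteq> {..<M}" "length w = n" "z \<in> word_map S w ` attr" "z' \<in> word_map S w ` attr"
    for w z z'
  proof -
    obtain u u' where u: "u \<in> attr" "u' \<in> attr" "z = word_map S w u" "z' = word_map S w u'"
      using w(3,4) by blast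
    have "norm u < R" "norm u' < R" using u R(2) by (auto simp: subset_iff)
    then have "dist u u' \<le> 2 * R"
      using dist_triangle2[of u u' 0] by simp
    then show ?thesis
      unfolding u dist_word_map[OF w(1)]
      using word_ratio_le_power[OF \<rho>(3,1) w(1)] w(2) \<rho>(1) by (intro mult_mono) auto
  qed
  obtain u k where u: "length u = n" "k < M" "walk M A i u k" "x \<in> word_map S u ` piece k"
    using piece_decomposition[OF i xy(1)] by blast
  obtain w l where w: "length w = n" "l < M" "walk M A i w l" "y \<in> word_map S w ` piece l"
    using piece_decomposition[OF i xy(2)] by blast
  have xu: "x \<in> word_map S u ` attr" and yw: "y \<in> word_map S w ` attr"
    using u(4) w(4) piece_subset_attr by blast+
  have disj: "word_map S u ` attr \<inter> word_map S w ` attr = {}"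
  proof (rule ccontr)
    assume "\<not> ?thesis"
    then obtain z where z: "z \<in> word_map S u ` attr" "z \<in> word_map S w ` attr" by blast
    have "dist x y \<le> dist x z + dist z y" by (rule dist_triangle)
    also have "\<dots> \<le> \<rho> ^ n * (2 * R) + \<rho> ^ n * (2 * R)"
      by (intro add_mono diam[OF walk_letters[OF u(3)] u(1) xu z(1)]
          diam[OF walk_letters[OF w(3)] w(1) z(2) yw])
    also have "\<dots> < dist x y" using n R(1) by (simp add: field_simps)
    finally show False by simp
  qed
  obtain q where q: "walk M A j q i" using conn[OF j i] by blast
  obtain p where p: "p \<noteq> []" "walk M A k p j" using conn[OF u(2) j] by blast
  obtain p' where p': "p' \<noteq> []" "walk M A l p' j" using conn[OF w(2) j] by blast
  show ?thesis
  proof (rule that)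
    show "walk M A j (q @ u @ p) j" "walk M A j (q @ w @ p') j"
      using q u(3) p(2) w(3) p'(2) unfolding walk_append by blast+
    have "word_map S (u @ p) ` piece j \<subseteq> word_map S u ` attr"
      using word_map_piece_subset[OF p(2)] piece_subset_attr[of k]
      unfolding word_map_append image_comp[symmetric] by blast
    moreover have "word_map S (w @ p') ` piece j \<subseteq> word_map S w ` attr"
      using word_map_piece_subset[OF p'(2)] piece_subset_attr[of l]
      unfolding word_map_append image_comp[symmetric] by blast
    ultimately show "word_map S (q @ u @ p) ` piece j \<inter> word_map S (q @ w @ p') ` piece j = {}"
      using disj by (intro image_append_disjoint walk_letters[OF q]) blast
  qed (use p(1) p'(1) in auto)
qed

lemma walk_concat_replicate: "walk M A j a j \<Longrightarrow> walk M A j (concat (replicate k a)) j"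
  by (induction k) (auto simp: walk_append)

lemma walk_tagged:
  "walk M A j a j \<Longrightarrow> walk M A j b j \<Longrightarrow> walk M A j x j \<Longrightarrow> walk M A j (tagged a b k x) j"
  unfolding tagged_def walk_append using walk_concat_replicate by blast

text \<open>
  After the common prefix \<open>a\<^sup>k\<close> one word continues with \<open>b\<close> and the other with \<open>a\<close>.
\<close>
lemma tagged_disjoint_less:
  assumes a: "walk M A j a j" and b: "walk M A j b j"
    and ab: "word_map S a ` piece j \<inter> word_map S b ` piece j = {}"
    and x: "walk M A j x j" and y: "walk M A j y j" and "k < l"
  shows "word_map S (tagged a b k x) ` piece j \<inter> word_map S (tagged a b l y) ` piece j = {}"
proof -
  obtain d where d: "l = k + Suc d" using less_imp_Suc_add[OF \<open>k < l\<close>] by auto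
  have eq: "tagged a b l y = concat (replicate k a) @ a @ tagged a b d y"
    by (simp add: tagged_def d replicate_add del: add_Suc_right)
  have "word_map S (b @ x) ` piece j \<subseteq> word_map S b ` piece j"
    using word_map_piece_subset[OF x] unfolding word_map_append image_comp[symmetric] by blast
  moreover have "word_map S (a @ tagged a b d y) ` piece j \<subseteq> word_map S a ` piece j"
    using word_map_piece_subset[OF walk_tagged[OF a b y]]
    unfolding word_map_append image_comp[symmetric] by blast
  ultimately show ?thesis
    unfolding eq unfolding tagged_def
    using ab by (intro image_append_disjoint walk_letters[OF walk_concat_replicate[OF a]]) blast
qed

lemma tagged_disjoint:
  assumes "walk M A j a j" "walk M A j b j"
    and "word_map S a ` piece j \<inter> word_map S b ` piece j = {}"
    and "walk M A j x j" "walk M A j y j" "k \<noteq> l"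
  shows "word_map S (tagged a b k x) ` piece j \<inter> word_map S (tagged a b l y) ` piece j = {}"
  using tagged_disjoint_less[OF assms(1-3), of x y k l] tagged_disjoint_less[OF assms(1-3), of y x l k]
    assms(4-6) by (cases k l rule: linorder_cases) auto

text \<open>
  The words \<open>b\<close> and \<open>a b\<close> recover the rotations of \<open>a\<close> and \<open>b\<close>, hence the rotation of the tag \<open>a\<^sup>k b\<close>, which can
  then be cancelled. Tagging a loop therefore costs nothing in the transformation group.
\<close>
lemma tagged_rotations_generate:
  assumes a: "set a \<subseteq> {..<M}" and b: "set b \<subseteq> {..<M}" and H: "subgroup H orthogonal_group"
    and "word_rotation T (tagged a b 0 []) \<in> H" "word_rotation T (tagged a b 1 []) \<in> H"
    and x: "word_rotation T (tagged a b k x) \<in> H"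
  shows "word_rotation T x \<in> H"
proof -
  let ?R = "word_rotation T"
  note cl = subgroup_orthogonal_closed[OF H]
  have oa: "orthogonal_matrix (?R a)" and ob: "orthogonal_matrix (?R b)"
    using orthogonal_word a b by blast+
  have Rb: "?R b \<in> H" and Rab: "?R a ** ?R b \<in> H" using assms(4,5) by (auto simp: tagged_def)
  have "?R a = (?R a ** ?R b) ** transpose (?R b)"
    using ob by (simp add: orthogonal_matrix_def flip: matrix_mul_assoc)
  then have Ra: "?R a \<in> H" using cl(2)[OF Rab cl(3)[OF Rb]] by simp
  have "?R (concat (replicate k a)) \<in> H"
    using Ra cl(1,2) by (induction k) auto
  then have P: "?R (concat (replicate k a)) ** ?R b \<in> H" using cl(2) Rb by blast
  have "?R x = transpose (?R (concat (replicate k a)) ** ?R b) ** ?R (tagged a b k x)"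
    using orthogonal_cancel(1)[OF cl(4)[OF P], of "?R x"]
    by (simp add: tagged_def matrix_mul_assoc)
  then show ?thesis using cl(2)[OF cl(3)[OF P] x] by simp
qed

section \<open>The self-similar subsystem\<close>

text \<open>
  The maps of loops at \<open>j\<close> send the compact piece at \<open>j\<close> into itself, so the attractor is found inside that piece
  and inherits separation from it. The sum of powers and the set of rotations are recorded over \<open>P\<close>, which
  hides the enumeration of \<open>P\<close> from the dimension and group arguments.
\<close>
lemma self_similar_system_of_loops:
  fixes P :: "'p set" and e :: "'p \<Rightarrow> nat list"
  assumes j: "j < M" and ne: "piece j \<noteq> {}" and P: "finite P" "P \<noteq> {}"
    and e: "\<And>\<pi>. \<pi> \<in> P \<Longrightarrow> e \<pi> \<noteq> [] \<and> walk M A j (e \<pi>) j"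
    and disj: "\<And>\<pi> \<pi>'. \<pi> \<in> P \<Longrightarrow> \<pi>' \<in> P \<Longrightarrow> \<pi> \<noteq> \<pi>' \<Longrightarrow>
      word_map S (e \<pi>) ` piece j \<inter> word_map S (e \<pi>') ` piece j = {}"
  obtains r' T' v' K where
    "contracting_similarities (card P) r' T'"
    "ifs_attractor (card P) (sim_system r' T' v') K"
    "strong_separation (card P) (sim_system r' T' v') K"
    "K \<subseteq> piece j"
    "\<And>t. (\<Sum>i<card P. r' i powr t) = (\<Sum>\<pi>\<in>P. word_ratio r (e \<pi>) powr t)"
    "T' ` {..<card P} = (\<lambda>\<pi>. word_rotation T (e \<pi>)) ` P"
proof -
  obtain h where h: "bij_betw h {..<card P} P"
    using ex_bij_betw_nat_finite[OF P(1)] by (auto simp: atLeast0LessThan)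
  have hP: "h i \<in> P" if "i < card P" for i using h that by (auto simp: bij_betw_def)
  have hne: "h i \<noteq> h k" if "i < card P" "k < card P" "i \<noteq> k" for i k
    using h that by (auto simp: bij_betw_def inj_on_def)
  define r' where "r' i = word_ratio r (e (h i))" for i
  define T' where "T' i = word_rotation T (e (h i))" for i
  define v' where "v' i = word_map S (e (h i)) 0" for i
  have sys: "sim_system r' T' v' i = word_map S (e (h i))" for i
    by (subst word_map_eq_similarity) (simp add: sim_system_def[of r'] r'_def T'_def v'_def)
  have e': "e (h i) \<noteq> []" "walk M A j (e (h i)) j" "set (e (h i)) \<subseteq> {..<M}" if "i < card P" for i
    using e[OF hP[OF that]] walk_letters by blast+
  have contr: "contracting_similarities (card P) r' T'"
    unfolding contracting_similarities_def r'_def T'_def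
    using word_ratio_pos word_ratio_less_1 orthogonal_word e' by blast
  have "0 < card P" using P by (simp add: card_gt_0_iff)
  then obtain K where K: "K \<subseteq> piece j" "ifs_attractor (card P) (sim_system r' T' v') K"
  proof (rule attractor_in_invariant_compact[OF compact_piece[OF j] ne])
    fix k assume "k < card P"
    note ek = e'[OF this]
    show "continuous_on UNIV (sim_system r' T' v' k)"
      unfolding sys by (rule continuous_word_map[OF ek(3)])
    show "inj (sim_system r' T' v' k)" unfolding sys by (rule inj_word_map[OF ek(3)])
    show "sim_system r' T' v' k ` piece j \<subseteq> piece j"
      unfolding sys by (rule word_map_piece_subset[OF ek(2)])
  qed blast
  have ss: "strong_separation (card P) (sim_system r' T' v') K"
    unfolding strong_separation_def sys using disj hP hne K(1) by blast
  have sum: "(\<Sum>i<card P. r' i powr t) = (\<Sum>\<pi>\<in>P. word_ratio r (e \<pi>) powr t)" for t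
    unfolding r'_def using sum.reindex_bij_betw[OF h] .
  have "T' ` {..<card P} = (\<lambda>\<pi>. word_rotation T (e \<pi>)) ` h ` {..<card P}"
    by (simp add: T'_def image_image)
  then have "T' ` {..<card P} = (\<lambda>\<pi>. word_rotation T (e \<pi>)) ` P"
    using h by (simp add: bij_betw_def)
  then show ?thesis using that[OF contr K(2) ss K(1) sum] by blast
qed

text \<open>
  The system consists of the words \<open>a\<^sup>k b x\<close>, in three groups: \<open>b\<close> and \<open>a b\<close>, which make tags invisible to the
  transformation group; tagged loops whose rotations generate the whole group; and the words of \<open>D\<close>,
  completed to loops, which carry the dimension. In the last group the tag depends only on the first
  letter of the word. It has to separate different first letters, because these are reached from \<open>j\<close> along
  different walks, but not words with the same first letter, which are separated by assumption.
  Consequently only finitely many tags and completions occur, and the factor \<open>c\<close> by which completing and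
  tagging shrink the ratios can be chosen before \<open>D\<close> is known.
\<close>
lemma self_similar_subsystem:
  assumes conn: "\<And>a b. a < M \<Longrightarrow> b < M \<Longrightarrow> \<exists>w. w \<noteq> [] \<and> walk M A a w b"
    and j: "j < M" and i0: "i0 < M" and xy: "x \<in> piece i0" "y \<in> piece i0" "x \<noteq> y"
  obtains c where "0 < c"
    "\<And>n D t. \<lbrakk>0 < n; finite D; 0 \<le> t;
       \<And>w. w \<in> D \<Longrightarrow> length w = n \<and> (\<exists>i<M. \<exists>k<M. walk M A i w k);
       \<And>u w. u \<in> D \<Longrightarrow> w \<in> D \<Longrightarrow> u \<noteq> w \<Longrightarrow> word_map S u ` attr \<inter> word_map S w ` attr = {}\<rbrakk> \<Longrightarrow>
     \<exists>m r' T' v' K. 2 \<le> m \<and> contracting_similarities m r' T' \<and>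
       ifs_attractor m (sim_system r' T' v') K \<and> strong_separation m (sim_system r' T' v') K \<and>
       K \<subseteq> piece j \<and>
       c powr t * (\<Sum>w\<in>D. word_ratio r w powr t) \<le> (\<Sum>i<m. r' i powr t) \<and>
       ifs_transformation_group m T' = sft_transformation_group M A T j"
proof -
  obtain a b where ab: "walk M A j a j" "walk M A j b j" "a \<noteq> []" "b \<noteq> []"
    "word_map S a ` piece j \<inter> word_map S b ` piece j = {}"
    by (rule two_disjoint_loops[OF conn j i0 xy])
  let ?e = "tagged a b"
  note tagged_walk = walk_tagged[OF ab(1,2)]
  have "\<forall>i. \<exists>w. i < M \<longrightarrow> walk M A i w j" using conn j by blast
  then obtain p where p: "\<And>i. i < M \<Longrightarrow> walk M A i (p i) j" by metis
  have "\<forall>i. \<exists>w. i < M \<longrightarrow> walk M A j w i" using conn j by blast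
  then obtain q where q: "\<And>i. i < M \<Longrightarrow> walk M A j (q i) i" by metis
  have "piece j \<noteq> {}" using word_map_piece_subset[OF q[OF i0]] xy(1) by blast
  define C where "C = insert 1 ((\<lambda>(i, k). word_ratio r (?e (3 + 2 * i) (q i)) * word_ratio r (p k)) `
      ({..<M} \<times> {..<M}))"
  define c where "c = Min C"
  have "finite C" "C \<noteq> {}" by (auto simp: C_def)
  have tagged_pos: "0 < word_ratio r (?e (3 + 2 * i) (q i))" if "i < M" for i
    using word_ratio_pos[OF walk_letters[OF walk_concat_replicate[OF ab(1)]]]
      word_ratio_pos[OF walk_letters[OF ab(2)]] word_ratio_pos[OF walk_letters[OF q[OF that]]]
    by (simp add: tagged_def)
  have "0 < c"
    unfolding c_def using \<open>finite C\<close> \<open>C \<noteq> {}\<close> tagged_pos word_ratio_pos[OF walk_letters[OF p]]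
    by (subst Min_gr_iff) (auto simp: C_def)
  have c_le: "c \<le> word_ratio r (?e (3 + 2 * i) (q i)) * word_ratio r (p k)" if "i < M" "k < M" for i k
    unfolding c_def using \<open>finite C\<close> that by (intro Min_le) (auto simp: C_def)
  define X where "X = insert (p j) ((\<lambda>i. q i @ p i) ` {..<M} \<union>
      (\<lambda>(i, k). q i @ i # p k) ` {(i, k). i < M \<and> k < M \<and> A $$ (i, k) = 1})"
  have "finite {(i, k). i < M \<and> k < M \<and> A $$ (i, k) = 1}"
    by (rule finite_subset[of _ "{..<M} \<times> {..<M}"]) auto
  then have "finite X" by (simp add: X_def)
  have "walk M A j (q i @ i # p k) j" if "i < M" "k < M" "A $$ (i, k) = 1" for i k
    using q[OF that(1)] p[OF that(2)] that unfolding walk_append by auto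
  moreover have "walk M A j (q i @ p i) j" if "i < M" for i
    using q[OF that] p[OF that] unfolding walk_append by auto
  ultimately have X: "walk M A j z j" if "z \<in> X" for z
    using that p[OF j] by (auto simp: X_def)
  show ?thesis
  proof (rule that[OF \<open>0 < c\<close>])
    fix n :: nat and D :: "nat list set" and t :: real
    assume n: "0 < n" and D: "finite D"
      and t: "0 \<le> t"
      and walks: "\<And>w. w \<in> D \<Longrightarrow> length w = n \<and> (\<exists>i<M. \<exists>k<M. walk M A i w k)"
      and disj: "\<And>u w. u \<in> D \<Longrightarrow> w \<in> D \<Longrightarrow> u \<noteq> w \<Longrightarrow>
        word_map S u ` attr \<inter> word_map S w ` attr = {}"
    have "\<exists>k<M. hd w < M \<and> walk M A (hd w) w k" if "w \<in> D" for w
    proof -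
      obtain i k where ik: "i < M" "k < M" "walk M A i w k" using walks \<open>w \<in> D\<close> by blast
      moreover have "hd w = i" using ik(3) walks[OF \<open>w \<in> D\<close>] n by (cases w) auto
      ultimately show ?thesis by blast
    qed
    then obtain ending where ending: "\<And>w. w \<in> D \<Longrightarrow> ending w < M \<and> hd w < M \<and> walk M A (hd w) w (ending w)"
      by metis
    define closed where "closed w = q (hd w) @ w @ p (ending w)" for w
    have closed: "walk M A j (closed w) j" if "w \<in> D" for w
      using q p ending[OF that] unfolding closed_def walk_append by blast
    have closed_disj: "word_map S (closed u) ` piece j \<inter> word_map S (closed w) ` piece j = {}"
      if uw: "u \<in> D" "w \<in> D" "u \<noteq> w" "hd u = hd w" for u w
    proof -
      have sub: "word_map S (z @ p (ending z)) ` piece j \<subseteq> word_map S z ` attr" if "z \<in> D" for z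
        using word_map_piece_subset[OF p] ending[OF that] piece_subset_attr
        unfolding word_map_append image_comp[symmetric] by blast
      have "set (q (hd w)) \<subseteq> {..<M}" using walk_letters[OF q] ending[OF uw(2)] by blast
      then show ?thesis
        unfolding closed_def uw(4) using disj[OF uw(1-3)] sub[OF uw(1)] sub[OF uw(2)]
        by (intro image_append_disjoint) blast+
    qed
    \<comment> \<open>Even tags from 2 on for generators and odd ones from 3 on for \<open>D\<close>; 0 and 1 mark \<open>b\<close> and \<open>a b\<close>.\<close>
    define tagX where "tagX z = (2 + 2 * to_nat z, z)" for z :: "nat list"
    define tagD where "tagD w = (3 + 2 * hd w, closed w)" for w
    define P where "P = {(0, []), (1, [])} \<union> tagX ` X \<union> tagD ` D"
    define e where "e = (\<lambda>(k, z). ?e k z)"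
    have "finite P" using D \<open>finite X\<close> by (simp add: P_def)
    have P2: "2 \<le> card P"
      using card_mono[OF \<open>finite P\<close>, of "{(0, []), (1, [])}"] by (simp add: P_def)
    have P_walk: "walk M A j z j" if "(k, z) \<in> P" for k z
      using that X closed by (auto simp: P_def tagX_def tagD_def)
    have e_walk: "e \<pi> \<noteq> [] \<and> walk M A j (e \<pi>) j" if "\<pi> \<in> P" for \<pi>
      using tagged_walk[OF P_walk] that ab(4) by (cases \<pi>) (auto simp: e_def tagged_def)
    have e_disj: "word_map S (e \<pi>) ` piece j \<inter> word_map S (e \<pi>') ` piece j = {}"
      if pi: "\<pi> \<in> P" "\<pi>' \<in> P" "\<pi> \<noteq> \<pi>'" for \<pi> \<pi>'
    proof -
      obtain k z where \<pi>: "\<pi> = (k, z)" by (cases \<pi>)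
      obtain k' z' where \<pi>': "\<pi>' = (k', z')" by (cases \<pi>')
      have w: "walk M A j z j" "walk M A j z' j" using P_walk pi \<pi> \<pi>' by auto
      show ?thesis
      proof (cases "k = k'")
        case False
        then show ?thesis unfolding \<pi> \<pi>' e_def prod.case by (rule tagged_disjoint[OF ab(1,2,5) w])
      next
        case True
        \<comment> \<open>Equal tags: parity and injectivity of \<open>to_nat\<close> leave only two elements of \<open>D\<close>.\<close>
        have "\<exists>u\<in>D. \<exists>w\<in>D. u \<noteq> w \<and> hd u = hd w \<and> z = closed u \<and> z' = closed w"
        proof -
          have par: "2 * a \<noteq> Suc (2 * b)" "Suc (2 * b) \<noteq> 2 * a" for a b :: nat by presburger+
          show ?thesis
            using pi unfolding \<pi> \<pi>' P_def tagX_def tagD_def True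
            by (auto simp: par) metis
        qed
        then obtain u w where "u \<in> D" "w \<in> D" "u \<noteq> w" "hd u = hd w" "z = closed u" "z' = closed w"
          by blast
        then have "word_map S z ` piece j \<inter> word_map S z' ` piece j = {}" using closed_disj by blast
        moreover have "set (concat (replicate k a) @ b) \<subseteq> {..<M}"
          using walk_letters[OF walk_concat_replicate[OF ab(1)]] walk_letters[OF ab(2)] by simp
        ultimately show ?thesis
          using image_append_disjoint[of "concat (replicate k a) @ b" z "piece j" z' "piece j"]
          by (simp add: \<pi> \<pi>' e_def tagged_def True)
      qed
    qed
    have "P \<noteq> {}" by (auto simp: P_def)
    obtain r' T' v' K where sys: "contracting_similarities (card P) r' T'"
      "ifs_attractor (card P) (sim_system r' T' v') K"
      "strong_separation (card P) (sim_system r' T' v') K" "K \<subseteq> piece j"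
      "\<And>t. (\<Sum>i<card P. r' i powr t) = (\<Sum>\<pi>\<in>P. word_ratio r (e \<pi>) powr t)"
      "T' ` {..<card P} = (\<lambda>\<pi>. word_rotation T (e \<pi>)) ` P"
      by (rule self_similar_system_of_loops[OF j \<open>piece j \<noteq> {}\<close> \<open>finite P\<close> \<open>P \<noteq> {}\<close> e_walk e_disj]) blast+
    have "inj_on tagD D"
    proof (rule inj_onI)
      fix u w assume uw: "u \<in> D" "w \<in> D" "tagD u = tagD w"
      then have "u @ p (ending u) = w @ p (ending w)" by (auto simp: tagD_def closed_def)
      moreover have "length u = length w" using walks uw by auto
      ultimately show "u = w" by simp
    qed
    have "c powr t * (\<Sum>w\<in>D. word_ratio r w powr t) = (\<Sum>w\<in>D. c powr t * word_ratio r w powr t)"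
      by (rule sum_distrib_left)
    also have "\<dots> \<le> (\<Sum>w\<in>D. word_ratio r (e (tagD w)) powr t)"
    proof (rule sum_mono)
      fix w assume w: "w \<in> D"
      have rw: "0 < word_ratio r w" using ending[OF w] walk_letters word_ratio_pos by blast
      have "word_ratio r (e (tagD w)) =
          (word_ratio r (?e (3 + 2 * hd w) (q (hd w))) * word_ratio r (p (ending w))) * word_ratio r w"
        by (simp add: e_def tagD_def tagged_def closed_def)
      then have "c * word_ratio r w \<le> word_ratio r (e (tagD w))"
        using c_le ending[OF w] rw by (simp add: mult_right_mono)
      then have "(c * word_ratio r w) powr t \<le> word_ratio r (e (tagD w)) powr t"
        using t rw \<open>0 < c\<close> by (intro powr_mono2) auto
      then show "c powr t * word_ratio r w powr t \<le> word_ratio r (e (tagD w)) powr t"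
        using rw \<open>0 < c\<close> by (simp add: powr_mult)
    qed
    also have "\<dots> = (\<Sum>\<pi>\<in>tagD ` D. word_ratio r (e \<pi>) powr t)"
      by (simp add: sum.reindex[OF \<open>inj_on tagD D\<close>])
    also have "\<dots> \<le> (\<Sum>\<pi>\<in>P. word_ratio r (e \<pi>) powr t)"
      using \<open>finite P\<close> by (intro sum_mono2) (auto simp: P_def)
    finally have sum: "c powr t * (\<Sum>w\<in>D. word_ratio r w powr t) \<le> (\<Sum>i<card P. r' i powr t)"
      by (simp add: sys(5))
    let ?R = "word_rotation T"
    have loops: "loop_words M A j = {w. w \<noteq> [] \<and> walk M A j w j}"
      by (rule loop_words_eq_walks[OF j])
    have G: "sft_transformation_group M A T j = generate orthogonal_group (?R ` loop_words M A j)"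
      by (simp add: sft_transformation_group_def word_rotation_def[abs_def])
    have H: "ifs_transformation_group (card P) T' = generate orthogonal_group (?R ` e ` P)"
      by (simp add: ifs_transformation_group_def sys(6) image_image)
    have "?R ` e ` P \<subseteq> ?R ` loop_words M A j"
      using e_walk unfolding loops by blast
    then have "generate orthogonal_group (?R ` e ` P) \<subseteq> generate orthogonal_group (?R ` loop_words M A j)"
      by (rule group.mono_generate[OF group_orthogonal_group])
    moreover have "generate orthogonal_group (?R ` loop_words M A j) \<subseteq> generate orthogonal_group (?R ` e ` P)"
    proof (rule group.generate_subgroup_incl[OF group_orthogonal_group])
      let ?H = "generate orthogonal_group (?R ` e ` P)"
      have "?R ` e ` P \<subseteq> carrier orthogonal_group"
        using e_walk orthogonal_word[OF walk_letters] unfolding orthogonal_group_simps by blast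
      then show sub: "subgroup ?H orthogonal_group"
        by (rule group.generate_is_subgroup[OF group_orthogonal_group])
      have eH: "?R (?e k z) \<in> ?H" if "(k, z) \<in> P" for k z
        using generate.incl[of "?R (e (k, z))" "?R ` e ` P" orthogonal_group] that by (auto simp: e_def)
      have XH: "?R z \<in> ?H" if "z \<in> X" for z
      proof (rule tagged_rotations_generate[OF walk_letters[OF ab(1)] walk_letters[OF ab(2)] sub])
        show "?R (?e 0 []) \<in> ?H" "?R (?e 1 []) \<in> ?H"
          by (rule eH, simp add: P_def)+
        show "?R (?e (2 + 2 * to_nat z) z) \<in> ?H"
          by (rule eH) (use that in \<open>simp add: P_def tagX_def\<close>)
      qed
      show "?R ` loop_words M A j \<subseteq> ?H"
      proof (rule image_subsetI)
        fix w assume "w \<in> loop_words M A j"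
        then have "walk M A j w j" by (simp add: loops)
        then show "?R w \<in> ?H"
          by (rule loop_rotations_generated[OF j p q sub, rotated -1])
            (auto intro!: XH simp: X_def simp del: word_rotation_simps word_rotation_append)
      qed
    qed
    ultimately have "ifs_transformation_group (card P) T' = sft_transformation_group M A T j"
      unfolding G H by blast
    then show "\<exists>m r' T' v' K. 2 \<le> m \<and> contracting_similarities m r' T' \<and>
       ifs_attractor m (sim_system r' T' v') K \<and> strong_separation m (sim_system r' T' v') K \<and>
       K \<subseteq> piece j \<and>
       c powr t * (\<Sum>w\<in>D. word_ratio r w powr t) \<le> (\<Sum>i<m. r' i powr t) \<and>
       ifs_transformation_group m T' = sft_transformation_group M A T j"
      by (intro exI[of _ "card P"] exI[of _ r'] exI[of _ T'] exI[of _ v'] exI[of _ K] conjI sys(1-4) sum P2)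
  qed
qed

end

section \<open>Dimension approximation\<close>

lemma ifs_dim_lower_bound:
  assumes "2 \<le> m" "contracting_similarities m r T"
    and "ifs_attractor m (sim_system r T v) K" "strong_separation m (sim_system r T v) K"
    and "1 \<le> (\<Sum>i<m. r i powr t)"
  shows "ereal t \<le> hausdorff_dim K"
proof (rule self_similar_dim_lower_bound)
  show "K \<noteq> {}" "compact K" "K = (\<Union>k<m. sim_system r T v k ` K)"
    using assms(3) by (auto simp: ifs_attractor_def)
  show "sim_system r T v i ` K \<inter> sim_system r T v k ` K = {}" if "i < m" "k < m" "i \<noteq> k" for i k
    using assms(4) that by (simp add: strong_separation_def)
  show "dist (sim_system r T v k x) (sim_system r T v k y) = r k * dist x y" if "k < m" for k x y
    using assms(2) that unfolding sim_system_def contracting_similarities_def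
    by (intro dist_similarity) auto
  show "0 < r k \<and> r k < 1" if "k < m" for k
    using assms(2) that by (auto simp: contracting_similarities_def)
qed (use assms in auto)

theorem theorem1p17:
  fixes M :: nat and A :: "nat mat"
    and r :: "nat \<Rightarrow> real" and T :: "nat \<Rightarrow> real^'d^'d" and v :: "nat \<Rightarrow> real^'d"
    and j :: nat
  assumes "A \<in> carrier_mat M M" and "elements_mat A \<subseteq> {0, 1}"
    and "irreducible_subshift M A"
    and "contracting_similarities M r T"
    and "\<exists>i<M. \<exists>x\<in>sft_attractor_at M A (sim_system r T v) i.
               \<exists>y\<in>sft_attractor_at M A (sim_system r T v) i. x \<noteq> y"
    and "j < M"
  shows "\<forall>\<epsilon>>0. \<exists>(m::nat) (r'::nat \<Rightarrow> real) (T'::nat \<Rightarrow> real^'d^'d) (v'::nat \<Rightarrow> real^'d) (K::(real^'d) set).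
           contracting_similarities m r' T' \<and>
           ifs_attractor m (sim_system r' T' v') K \<and>
           strong_separation m (sim_system r' T' v') K \<and>
           K \<subseteq> sft_attractor_at M A (sim_system r T v) j \<and>
           sft_attractor_at M A (sim_system r T v) j \<subseteq> sft_attractor M A (sim_system r T v) \<and>
           hausdorff_dim (sft_attractor M A (sim_system r T v)) - ereal \<epsilon> < hausdorff_dim K \<and>
           dense_subset (ifs_transformation_group m T') (sft_transformation_group M A T j)"
proof (intro allI impI)
  fix \<epsilon> :: real assume \<epsilon>: "0 < \<epsilon>"
  interpret sft_system M A r T v
    by unfold_locales (rule assms(4))
  have conn: "\<exists>w. w \<noteq> [] \<and> walk M A a w b" if "a < M" "b < M" for a b
    using irreducible_walk[OF assms(1-3) that] by blast
  obtain i x y where xy: "i < M" "x \<in> piece i" "y \<in> piece i" "x \<noteq> y" using assms(5) by blast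
  obtain c where c: "0 < c" "\<And>n D t. \<lbrakk>0 < n; finite D; 0 \<le> t;
       \<And>w. w \<in> D \<Longrightarrow> length w = n \<and> (\<exists>i<M. \<exists>k<M. walk M A i w k);
       \<And>u w. u \<in> D \<Longrightarrow> w \<in> D \<Longrightarrow> u \<noteq> w \<Longrightarrow> word_map S u ` attr \<inter> word_map S w ` attr = {}\<rbrakk> \<Longrightarrow>
     \<exists>m r' T' v' K. 2 \<le> m \<and> contracting_similarities m r' T' \<and>
       ifs_attractor m (sim_system r' T' v') K \<and> strong_separation m (sim_system r' T' v') K \<and>
       K \<subseteq> piece j \<and>
       c powr t * (\<Sum>w\<in>D. word_ratio r w powr t) \<le> (\<Sum>i<m. r' i powr t) \<and>
       ifs_transformation_group m T' = sft_transformation_group M A T j"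
    by (rule self_similar_subsystem[OF conn assms(6) xy]) blast+
  obtain \<sigma> where \<sigma>: "hausdorff_dim attr = ereal \<sigma>" "0 \<le> \<sigma>"
    using hausdorff_dim_nonneg[of attr] hausdorff_dim_attr_finite
    by (cases "hausdorff_dim attr") auto
  have "\<exists>m r' T' v' K. contracting_similarities m r' T' \<and>
       ifs_attractor m (sim_system r' T' v') K \<and> strong_separation m (sim_system r' T' v') K \<and>
       K \<subseteq> piece j \<and> ereal (\<sigma> - \<epsilon>) < hausdorff_dim K \<and>
       ifs_transformation_group m T' = sft_transformation_group M A T j"
  proof (cases "\<sigma> = 0")
    case True
    \<comment> \<open>The empty family suffices here, since every Hausdorff dimension is nonnegative.\<close>
    obtain m r' T' v' K where sys: "contracting_similarities m r' T'"
      "ifs_attractor m (sim_system r' T' v') K" "strong_separation m (sim_system r' T' v') K"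
      "K \<subseteq> piece j" "ifs_transformation_group m T' = sft_transformation_group M A T j"
      using c(2)[of 1 "{}" 1] by auto
    have "ereal (\<sigma> - \<epsilon>) < 0" using True \<epsilon> by simp
    then have "ereal (\<sigma> - \<epsilon>) < hausdorff_dim K" using hausdorff_dim_nonneg less_le_trans by blast
    then show ?thesis using sys by blast
  next
    case False
    \<comment> \<open>A positive exponent strictly between \<open>\<sigma> - \<epsilon>\<close> and \<open>\<sigma>\<close>; the midpoint of \<open>t\<close> and \<open>\<sigma>\<close> leaves room above it.\<close>
    define t where "t = max (\<sigma> - \<epsilon> / 2) (\<sigma> / 2)"
    have t: "0 < t" "t < \<sigma>" "\<sigma> - \<epsilon> < t" using False \<sigma>(2) \<epsilon> by (auto simp: t_def)
    have "hausdorff_measure ((t + \<sigma>) / 2) attr \<noteq> 0"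
      using t by (intro hausdorff_measure_nonzero_below_dim) (auto simp: \<sigma>(1))
    moreover have "0 \<le> t" "t < (t + \<sigma>) / 2" "0 < c powr (- t)" using t c(1) by auto
    ultimately obtain n D where D: "0 < n" "finite D"
      "\<And>w. w \<in> D \<Longrightarrow> length w = n \<and> (\<exists>i<M. \<exists>k<M. walk M A i w k)"
      "\<And>u w. u \<in> D \<Longrightarrow> w \<in> D \<Longrightarrow> u \<noteq> w \<Longrightarrow> word_map S u ` attr \<inter> word_map S w ` attr = {}"
      "c powr (- t) \<le> (\<Sum>w\<in>D. word_ratio r w powr t)"
      by (rule disjoint_cylinders_large_sum) blast
    obtain m r' T' v' K where sys: "2 \<le> m" "contracting_similarities m r' T'"
      "ifs_attractor m (sim_system r' T' v') K" "strong_separation m (sim_system r' T' v') K"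
      "K \<subseteq> piece j" "c powr t * (\<Sum>w\<in>D. word_ratio r w powr t) \<le> (\<Sum>i<m. r' i powr t)"
      "ifs_transformation_group m T' = sft_transformation_group M A T j"
      using c(2)[OF D(1,2) less_imp_le[OF t(1)] D(3,4)] by blast
    have "1 = c powr t * c powr (- t)" using c(1) by (simp flip: powr_add)
    also have "\<dots> \<le> c powr t * (\<Sum>w\<in>D. word_ratio r w powr t)" using D(5) by (intro mult_left_mono) auto
    also have "\<dots> \<le> (\<Sum>i<m. r' i powr t)" by (rule sys(6))
    finally have "ereal t \<le> hausdorff_dim K" by (rule ifs_dim_lower_bound[OF sys(1-4)])
    moreover have "ereal (\<sigma> - \<epsilon>) < ereal t" using t(3) by simp
    ultimately have "ereal (\<sigma> - \<epsilon>) < hausdorff_dim K" by (rule less_le_trans[rotated])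
    then show ?thesis
      by (intro exI[of _ m] exI[of _ r'] exI[of _ T'] exI[of _ v'] exI[of _ K] conjI sys(2-5,7))
  qed
  then obtain m r' T' v' K where sys: "contracting_similarities m r' T'"
      "ifs_attractor m (sim_system r' T' v') K" "strong_separation m (sim_system r' T' v') K"
      "K \<subseteq> piece j" "ereal (\<sigma> - \<epsilon>) < hausdorff_dim K"
      "ifs_transformation_group m T' = sft_transformation_group M A T j"
    by blast
  have "dense_subset (ifs_transformation_group m T') (sft_transformation_group M A T j)"
    unfolding sys(6) dense_subset_def using closure_subset by blast
  moreover have "hausdorff_dim attr - ereal \<epsilon> < hausdorff_dim K" using sys(5) by (simp add: \<sigma>(1))
  ultimately show "\<exists>m r' T' v' K. contracting_similarities m r' T' \<and>
           ifs_attractor m (sim_system r' T' v') K \<and>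
           strong_separation m (sim_system r' T' v') K \<and>
           K \<subseteq> piece j \<and> piece j \<subseteq> attr \<and>
           hausdorff_dim attr - ereal \<epsilon> < hausdorff_dim K \<and>
           dense_subset (ifs_transformation_group m T') (sft_transformation_group M A T j)"
    by (intro exI[of _ m] exI[of _ r'] exI[of _ T'] exI[of _ v'] exI[of _ K] conjI sys(1-4) piece_subset_attr)
qed

end
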